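(* Let $\beta\in\mathbb{R}$, let $s>1/2$, and let $u\in C(\mathbb{R},H^s_+(\mathbb{S}^1))$ be a solution of the $\beta$-Szegő equation $$i\partial_t u=\Pi(|u|^2u)-\beta\,S\,\Pi\big(|S^\dagger u|^2S^\dagger u\big).$$ Then $$\frac{dK_u}{dt}=\left[C_u-\beta B_{S^\dagger u},\,K_u\right].$$
   Context: $L^2_+(\mathbb{S}^1)$ is the closed subspace of $L^2(\mathbb{S}^1)$ of functions $h=\sum_{n\ge 0}h_ne^{in\theta}$ whose negative Fourier coefficients vanish; $H^s_+(\mathbb{S}^1)=H^s(\mathbb{S}^1)\cap L^2_+(\mathbb{S}^1)$. $\Pi:L^2(\mathbb{S}^1)\to L^2_+(\mathbb{S}^1)$ is the Szegő projector $\Pi(\sum_{n\in\mathbb{Z}}h_ne^{in\theta})=\sum_{n\ge0}h_ne^{in\theta}$. $S$ is the shift $Sh=e^{i\theta}h$ on $L^2_+$, and $S^\dagger$ is its adjoint, $(S^\dagger h)_n=h_{n+1}$ for $n\ge0$. For $u\in H^s_+$ with $s>1/2$, the following operators act on $L^2_+(\mathbb{S}^1)$: the antilinear Hankel operator $H_uh=\Pi(u\bar h)$; the linear Toeplitz operator $T_bh=\Pi(bh)$ for a bounded function $b$ on $\mathbb{S}^1$; the antilinear operator $K_u=S^\dagger H_u=H_uS=H_{S^\dagger u}$; and $$B_u=\tfrac{i}{2}H_u^2-iT_{|u|^2},\qquad C_u=\tfrac{i}{2}K_u^2-iT_{|u|^2}.$$ In particular $B_{S^\dagger u}=\tfrac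 i2 H_{S^\dagger u}^2-iT_{|S^\dagger u|^2}$. $[X,Y]=XY-YX$. *)

theory Defs
  imports "HOL-Analysis.Analysis"
begin

text \<open>
  Functions on the unit circle are functions of the angle \<open>\<theta>\<close>. Only their values almost everywhere
  on \<open>[0, 2\<pi>)\<close> matter: elements of \<open>L\<^sup>2\<close> are represented by functions rather than by classes, and the
  measure is normalised to total mass 1.
\<close>

definition circle :: "real measure" where
  "circle = uniform_measure lborel {0..<2 * pi}"

definition L2 :: "(real \<Rightarrow> complex) set" where
  "L2 = {f \<in> borel_measurable circle. integrable circle (\<lambda>\<theta>. (cmod (f \<theta>))\<^sup>2)}"

definition L2_norm :: "(real \<Rightarrow> complex) \<Rightarrow> real" where
  "L2_norm f = sqrt (LINT \<theta>|circle. (cmod (f \<theta>))\<^sup>2)"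

definition fourier :: "(real \<Rightarrow> complex) \<Rightarrow> int \<Rightarrow> complex" where
  "fourier f n = (LINT \<theta>|circle. f \<theta> * cis (- (of_int n * \<theta>)))"

definition L2_plus :: "(real \<Rightarrow> complex) set" where
  "L2_plus = {h \<in> L2. \<forall>n<0. fourier h n = 0}"

definition sobolev :: "real \<Rightarrow> (real \<Rightarrow> complex) set" where
  "sobolev s = {f \<in> L2.
     (\<lambda>n::int. (1 + (of_int n)\<^sup>2) powr s * (cmod (fourier f n))\<^sup>2) summable_on UNIV}"

definition sobolev_norm :: "real \<Rightarrow> (real \<Rightarrow> complex) \<Rightarrow> real" where
  "sobolev_norm s f =
     sqrt (\<Sum>\<^sub>\<infinity>n::int. (1 + (of_int n)\<^sup>2) powr s * (cmod (fourier f n))\<^sup>2)"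

definition sobolev_plus :: "real \<Rightarrow> (real \<Rightarrow> complex) set" where
  "sobolev_plus s = sobolev s \<inter> L2_plus"

text \<open>
  The \<open>L\<^sup>2\<close> function with prescribed Fourier coefficients \<open>a\<close>. For square-summable \<open>a\<close> it exists by
  the Riesz--Fischer theorem and is unique up to equality almost everywhere, so that the choice
  only picks a representative.
\<close>

definition fourier_series :: "(int \<Rightarrow> complex) \<Rightarrow> real \<Rightarrow> complex" where
  "fourier_series a = (SOME f. f \<in> L2 \<and> (\<forall>n. fourier f n = a n))"

definition szego_proj :: "(real \<Rightarrow> complex) \<Rightarrow> real \<Rightarrow> complex" where
  "szego_proj h = fourier_series (\<lambda>n. if n \<ge> 0 then fourier h n else 0)"

definition shift :: "(real \<Rightarrow> complex) \<Rightarrow> real \<Rightarrow> complex" where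
  "shift h = (\<lambda>\<theta>. cis \<theta> * h \<theta>)"

definition shift_adj :: "(real \<Rightarrow> complex) \<Rightarrow> real \<Rightarrow> complex" where
  "shift_adj h = fourier_series (\<lambda>n. if n \<ge> 0 then fourier h (n + 1) else 0)"

type_synonym operator = "(real \<Rightarrow> complex) \<Rightarrow> real \<Rightarrow> complex"

definition hankel :: "(real \<Rightarrow> complex) \<Rightarrow> operator" where
  "hankel u h = szego_proj (\<lambda>\<theta>. u \<theta> * cnj (h \<theta>))"

definition toeplitz :: "(real \<Rightarrow> complex) \<Rightarrow> operator" where
  "toeplitz b h = szego_proj (\<lambda>\<theta>. b \<theta> * h \<theta>)"

definition K_op :: "(real \<Rightarrow> complex) \<Rightarrow> operator" where
  "K_op u h = shift_adj (hankel u h)"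

definition abs_sq :: "(real \<Rightarrow> complex) \<Rightarrow> real \<Rightarrow> complex" where
  "abs_sq u = (\<lambda>\<theta>. complex_of_real ((cmod (u \<theta>))\<^sup>2))"

definition B_op :: "(real \<Rightarrow> complex) \<Rightarrow> operator" where
  "B_op u h = (\<lambda>\<theta>. \<i> / 2 * hankel u (hankel u h) \<theta> - \<i> * toeplitz (abs_sq u) h \<theta>)"

definition C_op :: "(real \<Rightarrow> complex) \<Rightarrow> operator" where
  "C_op u h = (\<lambda>\<theta>. \<i> / 2 * K_op u (K_op u h) \<theta> - \<i> * toeplitz (abs_sq u) h \<theta>)"

definition commutator :: "operator \<Rightarrow> operator \<Rightarrow> operator" where
  "commutator X Y h = (\<lambda>\<theta>. X (Y h) \<theta> - Y (X h) \<theta>)"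

definition continuous_sobolev_plus :: "real \<Rightarrow> (real \<Rightarrow> real \<Rightarrow> complex) \<Rightarrow> bool" where
  "continuous_sobolev_plus s u \<longleftrightarrow>
     (\<forall>t. u t \<in> sobolev_plus s) \<and>
     (\<forall>t. ((\<lambda>r. sobolev_norm s (\<lambda>\<theta>. u r \<theta> - u t \<theta>)) \<longlongrightarrow> 0) (at t))"

text \<open>
  The time derivative is taken in \<open>L\<^sup>2\<close>. This asks no more of a solution than a derivative in \<open>H\<^sup>s\<close>
  would. The requirement \<open>v \<in> L2\<close> excludes non-measurable \<open>v\<close>, for which \<^const>\<open>L2_norm\<close> is
  meaningless.
\<close>

definition has_L2_derivative ::
  "(real \<Rightarrow> real \<Rightarrow> complex) \<Rightarrow> (real \<Rightarrow> complex) \<Rightarrow> real \<Rightarrow> bool" where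
  "has_L2_derivative u v t \<longleftrightarrow> v \<in> L2 \<and>
     ((\<lambda>r. L2_norm (\<lambda>\<theta>. (u (t + r) \<theta> - u t \<theta>) / complex_of_real r - v \<theta>)) \<longlongrightarrow> 0) (at 0)"

definition solves_beta_szego :: "real \<Rightarrow> (real \<Rightarrow> real \<Rightarrow> complex) \<Rightarrow> bool" where
  "solves_beta_szego \<beta> u \<longleftrightarrow> (\<forall>t. \<exists>v. has_L2_derivative u v t \<and>
     (AE \<theta> in circle. \<i> * v \<theta> =
        szego_proj (\<lambda>\<theta>. abs_sq (u t) \<theta> * u t \<theta>) \<theta>
        - complex_of_real \<beta> * shift (szego_proj
            (\<lambda>\<theta>. abs_sq (shift_adj (u t)) \<theta> * shift_adj (u t) \<theta>)) \<theta>))"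

text \<open>
  Differentiability at \<open>t\<close> in the operator norm of bounded real-linear operators on \<open>L\<^sup>2\<^sub>+\<close> (hence
  also for antilinear ones): the norm of the difference quotient minus \<open>D\<close> tends to 0.
\<close>

definition has_operator_derivative :: "(real \<Rightarrow> operator) \<Rightarrow> operator \<Rightarrow> real \<Rightarrow> bool" where
  "has_operator_derivative A D t \<longleftrightarrow>
     (\<forall>r. \<forall>h\<in>L2_plus. A r h \<in> L2_plus) \<and> (\<forall>h\<in>L2_plus. D h \<in> L2_plus) \<and>
     (\<forall>\<epsilon>>0. \<forall>\<^sub>F r in at 0. \<forall>h\<in>L2_plus.
        L2_norm (\<lambda>\<theta>. (A (t + r) h \<theta> - A t h \<theta>) / complex_of_real r - D h \<theta>) \<le> \<epsilon> * L2_norm h)"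

end

theory Submission
  imports Defs
begin

text \<open>
  The operator \<open>K\<^sub>u\<close> is linear in \<open>u\<close>, so its derivative is \<open>K\<^sub>v\<close> with \<open>v = \<partial>\<^sub>t u\<close>, provided the
  difference quotients of \<open>u\<close> converge in a norm that controls the operator norm of \<open>K\<close>. The
  \<open>L\<^sup>2\<close> norm does not, but the Wiener norm \<open>\<Sum> \<bar>u\<^sub>n\<bar>\<close> does. For \<open>s > 1/2\<close> the curve \<open>u\<close> is continuous
  in the Wiener algebra, hence so is \<open>v\<close>, which is cubic in \<open>u\<close>; the mean value theorem for the
  Fourier coefficients then makes the difference quotients converge in the Wiener norm.

  The identity \<open>K\<^sub>v = [C\<^sub>u - \<beta> B\<^sub>w, K\<^sub>u]\<close> with \<open>w = S\<^sup>\<dagger> u\<close> follows from \<open>K\<^sub>u = H\<^sub>w\<close>,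
  \<open>K\<^bsub>S f\<^esub> = H\<^sub>f\<close> and the cubic identity \<open>X\<^sub>p = T X\<^sub>u + X\<^sub>u T - X\<^sub>u\<^sup>3\<close> for both \<open>X = H\<close> and \<open>X = K\<close>,
  where \<open>p = \<Pi> (\<bar>u\<bar>\<^sup>2 u)\<close> and \<open>T\<close> is the Toeplitz operator of \<open>\<bar>u\<bar>\<^sup>2\<close>.
\<close>

subsection \<open>The normalised measure on the circle\<close>

text \<open>The operators are built on \<open>fourier_series\<close>, which picks an arbitrary
  representative, so even additivity of the projector cannot be tested pointwise. Identities between
  operators are therefore compared on Fourier coefficients, and norms are recovered from
  coefficients by Parseval. This is why Fourier theory on the circle, up to completeness and
  Riesz-Fischer, precedes any operator.

  The Wiener norm is chosen for three properties. It bounds the sup norm, hence multiplication on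
  \<open>L2\<close> and with it the Hankel operators. It depends only on the moduli of the
  coefficients, so projection, shifts and conjugation, which just move or delete coefficients, do
  not increase it. It is submultiplicative by the interchange of a double sum, so continuity passes
  to the cubic right-hand side without the algebra property of \<open>H^s\<close>. The condition
  \<open>s > 1/2\<close> enters through Cauchy-Schwarz against the weight
  \<open>(1 + n^2) powr (- s)\<close>.\<close>

lemma sets_circle [measurable_cong, simp]: "sets circle = sets borel"
  by (simp add: circle_def)

lemma space_circle [simp]: "space circle = UNIV"
  by (simp add: circle_def)

lemma emeasure_period [simp]: "emeasure lborel {0..<2 * pi} = ennreal (2 * pi)"
  by simp

lemma emeasure_circle: "emeasure circle UNIV = 1"
  unfolding circle_def by (subst emeasure_uniform_measure) (auto simp: divide_ennreal)

interpretation circle: finite_measure circle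
  by (rule finite_measureI) (simp add: emeasure_circle)

lemma measure_circle [simp]: "measure circle UNIV = 1"
  by (simp add: measure_def emeasure_circle)

lemma AE_circle: "AE \<theta> in circle. 0 \<le> \<theta> \<and> \<theta> < 2 * pi"
  unfolding circle_def by (rule AE_uniform_measureI) auto

lemma measurable_circle_iff [simp]: "borel_measurable circle = borel_measurable borel"
  by (rule measurable_cong_sets) auto

text \<open>The half-open period becomes a closed interval, the form in which the fundamental
  theorem of calculus is applied; the added endpoint is a null set.\<close>

lemma integral_circle:
  fixes f :: "real \<Rightarrow> complex"
  assumes [measurable]: "f \<in> borel_measurable borel"
  shows "(LINT \<theta>|circle. f \<theta>) = (LINT \<theta>|lborel. indicator {0..2 * pi} \<theta> *\<^sub>R f \<theta>) / (2 * pi)"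
proof -
  have circle: "circle = density lborel (\<lambda>\<theta>. ennreal (indicator {0..<2 * pi} \<theta> / (2 * pi)))"
    unfolding circle_def uniform_measure_def emeasure_period
    by (intro arg_cong[where f="density lborel"] ext)
       (simp add: divide_ennreal flip: ennreal_indicator)
  have "(LINT \<theta>|circle. f \<theta>) = (LINT \<theta>|lborel. (indicator {0..<2 * pi} \<theta> / (2 * pi)) *\<^sub>R f \<theta>)"
    unfolding circle by (intro integral_density) auto
  also have "\<dots> = (LINT \<theta>|lborel. (indicator {0..2 * pi} \<theta> / (2 * pi)) *\<^sub>R f \<theta>)"
  proof (rule integral_cong_AE)
    show "AE \<theta> in lborel. (indicator {0..<2 * pi} \<theta> / (2 * pi)) *\<^sub>R f \<theta>
        = (indicator {0..2 * pi} \<theta> / (2 * pi)) *\<^sub>R f \<theta>"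
      using AE_lborel_singleton[of "2 * pi"]
      by eventually_elim (auto split: split_indicator)
  qed auto
  also have "\<dots> = (LINT \<theta>|lborel. (1 / (2 * pi)) *\<^sub>R (indicator {0..2 * pi} \<theta> *\<^sub>R f \<theta>))"
    by (rule Bochner_Integration.integral_cong) (auto split: split_indicator)
  also have "\<dots> = (1 / (2 * pi)) *\<^sub>R (LINT \<theta>|lborel. indicator {0..2 * pi} \<theta> *\<^sub>R f \<theta>)"
    by (rule integral_scaleR_right)
  finally show ?thesis
    by (simp add: scaleR_conv_of_real)
qed

lemma cis_measurable [measurable]: "cis \<in> borel_measurable borel"
  by (intro borel_measurable_continuous_onI continuous_intros)

lemma integral_circle_cis:
  "(LINT \<theta>|circle. cis (of_int k * \<theta>)) = (if k = 0 then 1 else 0)"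
proof (cases "k = 0")
  case False
  have "(LINT \<theta>|lborel. indicator {0..2 * pi} \<theta> *\<^sub>R cis (of_int k * \<theta>))
      = cis (of_int k * (2 * pi)) / (\<i> * of_int k) - cis (of_int k * 0) / (\<i> * of_int k)"
    by (rule integral_FTC_atLeastAtMost)
       (use False in \<open>auto intro!: derivative_eq_intros continuous_intros
          simp: has_vector_derivative_def scaleR_conv_of_real field_simps fun_eq_iff\<close>)
  also have "cis (of_int k * (2 * pi)) = 1"
    using cis_multiple_2pi[of "of_int k"] by (simp add: mult_ac)
  finally show ?thesis
    using False by (simp add: integral_circle)
qed simp

lemma integrable_circle_bounded:
  fixes f :: "real \<Rightarrow> 'a::{banach,second_countable_topology}"
  assumes "f \<in> borel_measurable borel" "AE \<theta> in circle. norm (f \<theta>) \<le> B"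
  shows "integrable circle f"
  using circle.integrable_const_bound[of f B] assms by auto

subsection \<open>Square integrable functions\<close>

lemma L2_measurable: "f \<in> L2 \<Longrightarrow> f \<in> borel_measurable borel"
  by (simp add: L2_def)

lemma L2_integrable_sq: "f \<in> L2 \<Longrightarrow> integrable circle (\<lambda>\<theta>. (cmod (f \<theta>))\<^sup>2)"
  by (simp add: L2_def)

lemma L2_I:
  "f \<in> borel_measurable borel \<Longrightarrow> integrable circle (\<lambda>\<theta>. (cmod (f \<theta>))\<^sup>2) \<Longrightarrow> f \<in> L2"
  by (simp add: L2_def)

lemma L2_mult_integrable:
  assumes "f \<in> L2" "g \<in> L2"
  shows "integrable circle (\<lambda>\<theta>. f \<theta> * g \<theta>)"
proof (rule Bochner_Integration.integrable_bound)
  show "integrable circle (\<lambda>\<theta>. (cmod (f \<theta>))\<^sup>2 + (cmod (g \<theta>))\<^sup>2)"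
    using assms by (simp add: L2_integrable_sq)
  have "cmod (f x * g x) \<le> (cmod (f x))\<^sup>2 + (cmod (g x))\<^sup>2" for x
  proof -
    have "0 \<le> cmod (f x) * cmod (g x)"
      by simp
    then show ?thesis
      using sum_squares_bound[of "cmod (f x)" "cmod (g x)"] unfolding norm_mult by linarith
  qed
  then show "AE x in circle. norm (f x * g x) \<le> norm ((cmod (f x))\<^sup>2 + (cmod (g x))\<^sup>2)"
    by (intro AE_I2) auto
qed (use assms[THEN L2_measurable] in measurable)

lemma L2_bounded:
  assumes "f \<in> borel_measurable borel" "AE \<theta> in circle. cmod (f \<theta>) \<le> B"
  shows "f \<in> L2"
proof (rule L2_I)
  show "integrable circle (\<lambda>\<theta>. (cmod (f \<theta>))\<^sup>2)"
  proof (rule integrable_circle_bounded)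
    show "AE \<theta> in circle. norm ((cmod (f \<theta>))\<^sup>2) \<le> B\<^sup>2"
      using assms(2) by eventually_elim (simp add: power_mono)
  qed (use assms(1) in measurable)
qed fact

lemma L2_const: "(\<lambda>_. c) \<in> L2"
  by (rule L2_bounded[of _ "cmod c"]) auto

lemma L2_integrable: "f \<in> L2 \<Longrightarrow> integrable circle f"
  using L2_mult_integrable[OF _ L2_const[of 1]] by simp

lemma L2_mult_bounded:
  assumes "f \<in> L2" "g \<in> borel_measurable borel" "AE \<theta> in circle. cmod (g \<theta>) \<le> B"
  shows "(\<lambda>\<theta>. g \<theta> * f \<theta>) \<in> L2"
proof (rule L2_I)
  show "integrable circle (\<lambda>\<theta>. (cmod (g \<theta> * f \<theta>))\<^sup>2)"
  proof (rule Bochner_Integration.integrable_bound)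
    show "integrable circle (\<lambda>\<theta>. B\<^sup>2 * (cmod (f \<theta>))\<^sup>2)"
      using assms by (simp add: L2_integrable_sq)
    show "AE \<theta> in circle. norm ((cmod (g \<theta> * f \<theta>))\<^sup>2) \<le> norm (B\<^sup>2 * (cmod (f \<theta>))\<^sup>2)"
      using assms(3)
      by eventually_elim (simp add: norm_mult power_mult_distrib mult_right_mono power_mono)
  qed (use assms L2_measurable[OF assms(1)] in measurable)
qed (use assms L2_measurable[OF assms(1)] in measurable)

lemma L2_scale: "f \<in> L2 \<Longrightarrow> (\<lambda>\<theta>. c * f \<theta>) \<in> L2"
  by (rule L2_mult_bounded[of _ _ "cmod c"]) auto

lemma L2_cnj: "f \<in> L2 \<Longrightarrow> (\<lambda>\<theta>. cnj (f \<theta>)) \<in> L2"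
  by (simp add: L2_def borel_measurable_complex_iff)

lemma L2_add:
  assumes "f \<in> L2" "g \<in> L2"
  shows "(\<lambda>\<theta>. f \<theta> + g \<theta>) \<in> L2"
proof (rule L2_I)
  show "integrable circle (\<lambda>\<theta>. (cmod (f \<theta> + g \<theta>))\<^sup>2)"
  proof (rule Bochner_Integration.integrable_bound)
    show "integrable circle (\<lambda>\<theta>. 2 * (cmod (f \<theta>))\<^sup>2 + 2 * (cmod (g \<theta>))\<^sup>2)"
      using assms by (simp add: L2_integrable_sq)
    have "(cmod (f x + g x))\<^sup>2 \<le> 2 * (cmod (f x))\<^sup>2 + 2 * (cmod (g x))\<^sup>2" for x
    proof -
      have "(cmod (f x + g x))\<^sup>2 \<le> (cmod (f x) + cmod (g x))\<^sup>2"
        by (intro power_mono norm_triangle_ineq) auto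
      also have "\<dots> \<le> 2 * (cmod (f x))\<^sup>2 + 2 * (cmod (g x))\<^sup>2"
        using sum_squares_bound[of "cmod (f x)" "cmod (g x)"] unfolding power2_sum by linarith
      finally show ?thesis .
    qed
    then show "AE x in circle. norm ((cmod (f x + g x))\<^sup>2)
        \<le> norm (2 * (cmod (f x))\<^sup>2 + 2 * (cmod (g x))\<^sup>2)"
      by (intro AE_I2) auto
  qed (use assms[THEN L2_measurable] in measurable)
qed (use assms[THEN L2_measurable] in measurable)

lemma L2_diff: "f \<in> L2 \<Longrightarrow> g \<in> L2 \<Longrightarrow> (\<lambda>\<theta>. f \<theta> - g \<theta>) \<in> L2"
  using L2_add[OF _ L2_scale[of g "-1"]] by simp

lemma L2_sum: "(\<And>i. i \<in> I \<Longrightarrow> f i \<in> L2) \<Longrightarrow> (\<lambda>\<theta>. \<Sum>i\<in>I. f i \<theta>) \<in> L2"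
  by (induction I rule: infinite_finite_induct) (simp_all add: L2_add L2_const)

lemma L2_norm_nonneg [simp]: "0 \<le> L2_norm f"
  unfolding L2_norm_def by simp

lemma L2_norm_sq: "(L2_norm f)\<^sup>2 = (LINT \<theta>|circle. (cmod (f \<theta>))\<^sup>2)"
  unfolding L2_norm_def by simp

text \<open>The variance of \<open>cmod (f \<theta>)\<close> is nonnegative; here
  \<open>circle\<close> is used as a probability space.\<close>

lemma integral_norm_le_L2_norm:
  assumes "f \<in> L2"
  shows "(LINT \<theta>|circle. cmod (f \<theta>)) \<le> L2_norm f"
proof -
  define m where "m = (LINT \<theta>|circle. cmod (f \<theta>))"
  have [simp]: "integrable circle (\<lambda>\<theta>. cmod (f \<theta>))" "integrable circle (\<lambda>\<theta>. (cmod (f \<theta>))\<^sup>2)"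
    using assms L2_integrable L2_integrable_sq by auto
  have "0 \<le> (LINT \<theta>|circle. (cmod (f \<theta>) - m)\<^sup>2)"
    by simp
  also have "\<dots> = (LINT \<theta>|circle. (cmod (f \<theta>))\<^sup>2 - 2 * m * cmod (f \<theta>) + m\<^sup>2)"
    by (rule Bochner_Integration.integral_cong) (simp_all add: power2_diff)
  also have "\<dots> = (LINT \<theta>|circle. (cmod (f \<theta>))\<^sup>2) - 2 * m * m + m\<^sup>2"
    by (simp add: m_def)
  finally have "m\<^sup>2 \<le> (L2_norm f)\<^sup>2"
    unfolding L2_norm_sq by (simp add: power2_eq_square[of m])
  then show ?thesis
    unfolding m_def by (rule power2_le_imp_le) simp
qed

subsection \<open>Fourier coefficients\<close>

lemma integrable_mult_cis:
  "integrable circle f \<Longrightarrow> integrable circle (\<lambda>\<theta>. f \<theta> * cis (a * \<theta>))"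
  by (rule Bochner_Integration.integrable_bound[of _ f])
     (auto simp: norm_mult dest!: borel_measurable_integrable)

lemma integrable_mult_cis_minus:
  "integrable circle f \<Longrightarrow> integrable circle (\<lambda>\<theta>. f \<theta> * cis (- (a * \<theta>)))"
  using integrable_mult_cis[of f "-a"] by simp

lemma fourier_cong_AE:
  assumes "f \<in> borel_measurable borel" "g \<in> borel_measurable borel"
    and "AE \<theta> in circle. f \<theta> = g \<theta>"
  shows "fourier f = fourier g"
  unfolding fourier_def using assms(3)
  by (intro ext integral_cong_AE) (use assms(1,2) in \<open>auto elim!: eventually_mono\<close>)

lemma fourier_add:
  "integrable circle f \<Longrightarrow> integrable circle g \<Longrightarrow>
    fourier (\<lambda>\<theta>. f \<theta> + g \<theta>) n = fourier f n + fourier g n"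
  unfolding fourier_def by (simp add: ring_distribs integrable_mult_cis_minus)

lemma fourier_diff:
  "integrable circle f \<Longrightarrow> integrable circle g \<Longrightarrow>
    fourier (\<lambda>\<theta>. f \<theta> - g \<theta>) n = fourier f n - fourier g n"
  unfolding fourier_def by (simp add: ring_distribs integrable_mult_cis_minus)

lemma fourier_scale: "fourier (\<lambda>\<theta>. c * f \<theta>) n = c * fourier f n"
  unfolding fourier_def by (simp add: mult.assoc)

lemma fourier_sum:
  "(\<And>i. i \<in> I \<Longrightarrow> integrable circle (f i)) \<Longrightarrow>
    fourier (\<lambda>\<theta>. \<Sum>i\<in>I. f i \<theta>) n = (\<Sum>i\<in>I. fourier (f i) n)"
  unfolding fourier_def by (simp add: sum_distrib_right integrable_mult_cis_minus)

lemma fourier_cnj: "fourier (\<lambda>\<theta>. cnj (f \<theta>)) n = cnj (fourier f (- n))"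
  unfolding fourier_def by (simp add: cis_cnj flip: Bochner_Integration.integral_cnj)

lemma fourier_mult_cis: "fourier (\<lambda>\<theta>. cis (of_int k * \<theta>) * f \<theta>) n = fourier f (n - k)"
proof -
  have "cis (of_int k * \<theta>) * f \<theta> * cis (- (of_int n * \<theta>)) = f \<theta> * cis (- (of_int (n - k) * \<theta>))" for \<theta>
  proof -
    have "cis (of_int k * \<theta>) * f \<theta> * cis (- (of_int n * \<theta>))
        = f \<theta> * (cis (of_int k * \<theta>) * cis (- (of_int n * \<theta>)))"
      by (simp only: mult_ac)
    then show ?thesis
      by (simp add: cis_mult algebra_simps)
  qed
  then show ?thesis
    unfolding fourier_def by presburger
qed

lemma cis_L2: "(\<lambda>\<theta>. cis (a * \<theta>)) \<in> L2"
  by (rule L2_bounded[of _ 1]) auto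

lemma L2_mult_cis: "f \<in> L2 \<Longrightarrow> (\<lambda>\<theta>. cis (a * \<theta>) * f \<theta>) \<in> L2"
  by (rule L2_mult_bounded[of _ _ 1]) auto

lemma fourier_cis: "fourier (\<lambda>\<theta>. cis (of_int k * \<theta>)) n = (if n = k then 1 else 0)"
proof -
  have "fourier (\<lambda>\<theta>. cis (of_int k * \<theta>)) n = (LINT \<theta>|circle. cis (of_int (k - n) * \<theta>))"
    unfolding fourier_def by (simp add: cis_mult algebra_simps)
  then show ?thesis
    by (simp only: integral_circle_cis) auto
qed

lemma cmod_fourier_le: "f \<in> L2 \<Longrightarrow> cmod (fourier f n) \<le> L2_norm f"
  unfolding fourier_def
  by (rule order_trans[OF integral_norm_bound order_trans[OF _ integral_norm_le_L2_norm]])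
     (simp_all add: norm_mult)

section \<open>Trigonometric polynomials and Bessel's inequality\<close>

definition trig_poly :: "int set \<Rightarrow> (int \<Rightarrow> complex) \<Rightarrow> real \<Rightarrow> complex" where
  "trig_poly F c = (\<lambda>\<theta>. \<Sum>n\<in>F. c n * cis (of_int n * \<theta>))"

lemma trig_poly_L2: "trig_poly F c \<in> L2"
  unfolding trig_poly_def by (intro L2_sum L2_scale cis_L2)

lemma fourier_trig_poly: "finite F \<Longrightarrow> fourier (trig_poly F c) n = (if n \<in> F then c n else 0)"
  unfolding trig_poly_def
  by (subst fourier_sum) (auto intro!: L2_integrable L2_scale cis_L2 simp: fourier_scale fourier_cis if_distrib cong: if_cong)

lemma integral_mult_cnj_trig_poly:
  assumes "f \<in> L2"
  shows "(LINT \<theta>|circle. f \<theta> * cnj (trig_poly F c \<theta>)) = (\<Sum>n\<in>F. cnj (c n) * fourier f n)"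
proof -
  have "(LINT \<theta>|circle. f \<theta> * cnj (trig_poly F c \<theta>))
      = (LINT \<theta>|circle. (\<Sum>n\<in>F. cnj (c n) * (f \<theta> * cis (- (of_int n * \<theta>)))))"
    by (simp add: trig_poly_def cis_cnj sum_distrib_left mult_ac)
  also have "\<dots> = (\<Sum>n\<in>F. cnj (c n) * fourier f n)"
    unfolding fourier_def
    by (subst Bochner_Integration.integral_sum)
       (auto intro!: Bochner_Integration.integrable_mult_right integrable_mult_cis_minus
          L2_integrable[OF assms])
  finally show ?thesis .
qed

lemma L2_norm_sq_complex: "complex_of_real ((L2_norm f)\<^sup>2) = (LINT \<theta>|circle. f \<theta> * cnj (f \<theta>))"
  unfolding L2_norm_sq complex_norm_square[symmetric] by (simp del: of_real_power)

lemma L2_norm_trig_poly: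
  assumes "finite F"
  shows "(L2_norm (trig_poly F c))\<^sup>2 = (\<Sum>n\<in>F. (cmod (c n))\<^sup>2)"
proof -
  have "complex_of_real ((L2_norm (trig_poly F c))\<^sup>2) = complex_of_real (\<Sum>n\<in>F. (cmod (c n))\<^sup>2)"
    unfolding L2_norm_sq_complex integral_mult_cnj_trig_poly[OF trig_poly_L2]
    by (simp add: fourier_trig_poly assms complex_norm_square mult.commute del: of_real_power)
  then show ?thesis
    using of_real_eq_iff by blast
qed

text \<open>For the partial sum \<open>P\<close> over \<open>F\<close>, the products of
  \<open>f\<close> with \<open>P\<close>, of \<open>P\<close> with \<open>f\<close> and of
  \<open>P\<close> with itself all equal \<open>s\<close>. So the squared norm of
  \<open>f - P\<close> is that of \<open>f\<close> minus \<open>s\<close>, and it cannot be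
  negative.\<close>

lemma bessel:
  assumes "f \<in> L2" "finite F"
  shows "(\<Sum>n\<in>F. (cmod (fourier f n))\<^sup>2) \<le> (L2_norm f)\<^sup>2"
proof -
  define P where "P = trig_poly F (fourier f)"
  define s where "s = (\<Sum>n\<in>F. (cmod (fourier f n))\<^sup>2)"
  have P: "P \<in> L2"
    unfolding P_def by (rule trig_poly_L2)
  have int: "integrable circle (\<lambda>\<theta>. g \<theta> * cnj (h \<theta>))" if "g \<in> L2" "h \<in> L2" for g h
    by (rule L2_mult_integrable[OF that(1) L2_cnj[OF that(2)]])
  have fP: "(LINT \<theta>|circle. f \<theta> * cnj (P \<theta>)) = of_real s"
    unfolding P_def integral_mult_cnj_trig_poly[OF assms(1)] s_def
    by (simp add: complex_norm_square mult.commute del: of_real_power)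
  have Pf: "(LINT \<theta>|circle. P \<theta> * cnj (f \<theta>)) = of_real s"
    using arg_cong[OF fP, of cnj] by (simp flip: Bochner_Integration.integral_cnj add: mult.commute)
  have PP: "(LINT \<theta>|circle. P \<theta> * cnj (P \<theta>)) = of_real s"
    using L2_norm_trig_poly[OF assms(2), of "fourier f"]
    by (simp flip: L2_norm_sq_complex add: P_def s_def del: of_real_power)
  have "complex_of_real ((L2_norm (\<lambda>\<theta>. f \<theta> - P \<theta>))\<^sup>2)
      = (LINT \<theta>|circle. f \<theta> * cnj (f \<theta>) - f \<theta> * cnj (P \<theta>) - (P \<theta> * cnj (f \<theta>) - P \<theta> * cnj (P \<theta>)))"
    unfolding L2_norm_sq_complex by (simp add: algebra_simps)
  also have "\<dots> = complex_of_real ((L2_norm f)\<^sup>2 - s)"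
    by (simp add: int P assms(1) fP Pf PP flip: L2_norm_sq_complex)
  finally have "(L2_norm (\<lambda>\<theta>. f \<theta> - P \<theta>))\<^sup>2 = (L2_norm f)\<^sup>2 - s"
    using of_real_eq_iff by blast
  then show ?thesis
    unfolding s_def[symmetric] by (metis diff_ge_0_iff_ge zero_le_power2)
qed

subsection \<open>Completeness of the trigonometric system\<close>

text \<open>Vanishing of all coefficients survives multiplication by \<open>cis \<theta>\<close> and
  \<open>cis (- \<theta>)\<close>, which only shift the index. A real-linear \<open>p\<close> on the
  circle is \<open>a cos \<theta> + b sin \<theta>\<close>, a combination of these two. A product is
  handled as \<open>p\<close> acting on \<open>q\<close> times \<open>f\<close>, which is why the
  induction generalises over \<open>f\<close>.\<close>

lemma fourier_eq_0_mult_polynomial: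
  assumes "real_polynomial_function p" "integrable circle f" "\<And>n. fourier f n = 0"
  shows "integrable circle (\<lambda>\<theta>. of_real (p (cis \<theta>)) * f \<theta>)
    \<and> (\<forall>n. fourier (\<lambda>\<theta>. of_real (p (cis \<theta>)) * f \<theta>) n = 0)"
  using assms
proof (induction arbitrary: f rule: real_polynomial_function.induct)
  case (linear p)
  interpret bounded_linear p by fact
  define a b where "a = p 1" and "b = p \<i>"
  have p: "p (cis \<theta>) = cos \<theta> * a + sin \<theta> * b" for \<theta>
  proof -
    have "cis \<theta> = cos \<theta> *\<^sub>R 1 + sin \<theta> *\<^sub>R \<i>"
      by (simp add: complex_eq_iff)
    then show ?thesis
      by (simp add: add scaleR a_def b_def)
  qed
  have eq: "of_real (p (cis \<theta>)) * f \<theta>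
      = (a - \<i> * b) / 2 * (cis (of_int 1 * \<theta>) * f \<theta>)
        + (a + \<i> * b) / 2 * (cis (of_int (- 1) * \<theta>) * f \<theta>)" for \<theta>
    unfolding p by (simp add: complex_eq_iff algebra_simps add_divide_distrib diff_divide_distrib)
  have int: "integrable circle (\<lambda>\<theta>. c * (cis (of_int k * \<theta>) * f \<theta>))" for c k
    using integrable_mult_cis[OF linear.prems(1), of "of_int k"]
    by (simp add: mult.commute[of "f _"])
  show ?case
    unfolding eq using linear.prems(2)
    by (intro conjI allI int Bochner_Integration.integrable_add)
       (simp only: fourier_add[OF int int] fourier_scale fourier_mult_cis mult_zero_right add_0)
next
  case (const c)
  then show ?case by (simp add: fourier_scale)
next
  case (add p q)
  from add.IH(1)[OF add.prems] add.IH(2)[OF add.prems] show ?case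
    by (simp add: ring_distribs fourier_add)
next
  case (mult p q)
  from mult.IH(2)[OF mult.prems]
  have "integrable circle (\<lambda>\<theta>. of_real (q (cis \<theta>)) * f \<theta>)"
    "\<And>n. fourier (\<lambda>\<theta>. of_real (q (cis \<theta>)) * f \<theta>) n = 0"
    by auto
  from mult.IH(1)[OF this] show ?case
    by (simp add: mult.assoc)
qed

text \<open>Real polynomials are uniformly dense in the continuous functions on the circle by
  Stone-Weierstrass, and pairing with an integrable \<open>f\<close> is continuous under uniform
  convergence.\<close>

lemma integral_continuous_eq_0:
  assumes f: "integrable circle f" "\<And>n. fourier f n = 0"
    and g: "continuous_on (sphere 0 1) g"
  shows "(LINT \<theta>|circle. of_real (g (cis \<theta>)) * f \<theta>) = 0"
proof -
  have "continuous_on UNIV (\<lambda>\<theta>. g (cis \<theta>))"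
    by (rule continuous_on_compose2[OF g]) (auto intro!: continuous_intros)
  then have [measurable]: "(\<lambda>\<theta>. g (cis \<theta>)) \<in> borel_measurable borel"
    by (rule borel_measurable_continuous_onI)
  have [measurable]: "f \<in> borel_measurable borel"
    using f(1) by (auto dest: borel_measurable_integrable)
  define M where "M = (LINT \<theta>|circle. cmod (f \<theta>))"
  have M: "M \<ge> 0"
    unfolding M_def by simp
  have "cmod (LINT \<theta>|circle. of_real (g (cis \<theta>)) * f \<theta>) \<le> e" if "e > 0" for e
  proof -
    \<comment> \<open>The final error is \<open>d * M\<close>; the \<open>+ 1\<close> keeps the
      quotient meaningful when \<open>M = 0\<close>.\<close>
    define d where "d = e / (M + 1)"
    have d: "d > 0"
      unfolding d_def using that M by simp
    obtain p where p: "real_polynomial_function p" "\<And>x. x \<in> sphere 0 1 \<Longrightarrow> \<bar>g x - p x\<bar> < d"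
      by (rule Stone_Weierstrass_real_polynomial_function[OF _ g d]) auto
    from fourier_eq_0_mult_polynomial[OF p(1) f]
    have int_p: "integrable circle (\<lambda>\<theta>. of_real (p (cis \<theta>)) * f \<theta>)"
      and "fourier (\<lambda>\<theta>. of_real (p (cis \<theta>)) * f \<theta>) 0 = 0"
      by auto
    then have p0: "(LINT \<theta>|circle. of_real (p (cis \<theta>)) * f \<theta>) = 0"
      by (simp add: fourier_def)
    have bd: "cmod (of_real (g (cis \<theta>)) * f \<theta> - of_real (p (cis \<theta>)) * f \<theta>) \<le> d * cmod (f \<theta>)" for \<theta>
    proof -
      have "cmod (of_real (g (cis \<theta>) - p (cis \<theta>)) * f \<theta>) \<le> d * cmod (f \<theta>)"
        unfolding norm_mult norm_of_real
        using p(2)[of "cis \<theta>"] by (intro mult_right_mono) (auto simp: less_imp_le)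
      then show ?thesis
        by (simp add: left_diff_distrib)
    qed
    have [measurable]: "(\<lambda>\<theta>. of_real (p (cis \<theta>)) * f \<theta>) \<in> borel_measurable borel"
      using int_p by (auto dest: borel_measurable_integrable)
    have int_d: "integrable circle (\<lambda>\<theta>. of_real (g (cis \<theta>)) * f \<theta> - of_real (p (cis \<theta>)) * f \<theta>)"
      by (rule Bochner_Integration.integrable_bound[of _ "\<lambda>\<theta>. d * cmod (f \<theta>)"])
         (use f(1) bd d in \<open>auto simp: abs_mult\<close>)
    have "(LINT \<theta>|circle. of_real (g (cis \<theta>)) * f \<theta>)
        = (LINT \<theta>|circle. (of_real (g (cis \<theta>)) * f \<theta> - of_real (p (cis \<theta>)) * f \<theta>)
            + of_real (p (cis \<theta>)) * f \<theta>)"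
      by simp
    also have "\<dots> = (LINT \<theta>|circle. of_real (g (cis \<theta>)) * f \<theta> - of_real (p (cis \<theta>)) * f \<theta>)"
      by (subst Bochner_Integration.integral_add[OF int_d int_p]) (simp add: p0)
    also have "cmod \<dots> \<le> (LINT \<theta>|circle. d * cmod (f \<theta>))"
      by (rule Bochner_Integration.integral_norm_bound_integral[OF int_d]) (use f(1) bd in auto)
    also have "\<dots> = d * M"
      by (simp add: M_def)
    also have "\<dots> \<le> e"
      unfolding d_def using that M by (simp add: field_simps)
    finally show ?thesis .
  qed
  then have "cmod (LINT \<theta>|circle. of_real (g (cis \<theta>)) * f \<theta>) \<le> 0"
    by (rule field_le_epsilon) simp
  then show ?thesis
    by simp
qed

lemma cis_inj_period:
  assumes "cis x = cis y" "0 \<le> x" "x < 2 * pi" "0 \<le> y" "y < 2 * pi"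
  shows "x = y"
proof -
  obtain n :: int where n: "x = y + 2 * pi * of_int n"
    using assms(1) sin_cos_eq_iff[of x y] by (auto simp: complex_eq_iff)
  have "\<bar>2 * pi * of_int n\<bar> < 2 * pi * 1"
    using n assms(2-) by linarith
  then have "\<bar>real_of_int n\<bar> < 1"
    by (subst (asm) abs_mult) (simp add: abs_mult)
  then have "n = 0"
    by linarith
  then show ?thesis
    using n by simp
qed

text \<open>For \<open>c\<close> inside the period, the half-line cuts out a closed arc, whose
  indicator is a pointwise limit of continuous functions on the circle; dominated convergence
  transfers the vanishing. For other \<open>c\<close> the indicator is constant on the
  period.\<close>

lemma integral_atMost_eq_0:
  assumes f: "integrable circle f" "\<And>n. fourier f n = 0"
  shows "(LINT \<theta>|circle. indicator {..c} \<theta> *\<^sub>R f \<theta>) = 0"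
proof -
  have [measurable]: "f \<in> borel_measurable borel"
    using f(1) by (auto dest: borel_measurable_integrable)
  consider "c < 0" | "0 \<le> c" "c < 2 * pi" | "2 * pi \<le> c"
    by linarith
  then show ?thesis
  proof cases
    case 1
    have "(LINT \<theta>|circle. indicator {..c} \<theta> *\<^sub>R f \<theta>) = (LINT \<theta>|circle. 0)"
    proof (rule integral_cong_AE)
      show "AE \<theta> in circle. indicator {..c} \<theta> *\<^sub>R f \<theta> = 0"
        using AE_circle by eventually_elim (use 1 in \<open>auto simp: indicator_def\<close>)
    qed auto
    then show ?thesis by simp
  next
    case 3
    have "(LINT \<theta>|circle. indicator {..c} \<theta> *\<^sub>R f \<theta>) = (LINT \<theta>|circle. f \<theta>)"
    proof (rule integral_cong_AE)
      show "AE \<theta> in circle. indicator {..c} \<theta> *\<^sub>R f \<theta> = f \<theta>"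
        using AE_circle by eventually_elim (use 3 in \<open>auto simp: indicator_def\<close>)
    qed auto
    also have "\<dots> = fourier f 0"
      by (simp add: fourier_def)
    finally show ?thesis using f(2) by simp
  next
    case 2
    define C where "C = cis ` {0..c}"
    have C: "compact C" "C \<noteq> {}"
      unfolding C_def using 2 by (auto intro!: compact_continuous_image continuous_intros)
    \<comment> \<open>Tents around the arc \<open>C\<close>: equal to 1 on \<open>C\<close>, and 0
      as soon as \<open>k\<close> times the distance to \<open>C\<close> reaches 1.\<close>
    define g where "g k z = max 0 (1 - real k * infdist z C)" for k z
    have g_cont: "continuous_on S (g k)" for S k
      unfolding g_def by (intro continuous_intros)
    have g01: "0 \<le> g k z" "g k z \<le> 1" for k z
      unfolding g_def using infdist_nonneg[of z C] by auto
    have [measurable]: "(\<lambda>\<theta>. g k (cis \<theta>)) \<in> borel_measurable borel" for k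
      by (intro borel_measurable_continuous_onI continuous_on_compose2[OF g_cont[of UNIV]]
          continuous_intros) auto
    have lim: "(\<lambda>k. of_real (g k (cis \<theta>)) * f \<theta>) \<longlonglongrightarrow> indicator {..c} \<theta> *\<^sub>R f \<theta>"
      if "0 \<le> \<theta> \<and> \<theta> < 2 * pi" for \<theta>
    proof (cases "\<theta> \<le> c")
      case True
      then have "cis \<theta> \<in> C"
        unfolding C_def using that by auto
      then show ?thesis
        using True by (simp add: g_def)
    next
      case False
      have "cis \<theta> \<notin> C"
        unfolding C_def using that 2 False by (auto dest!: cis_inj_period)
      then have pos: "infdist (cis \<theta>) C > 0"
        using C by (metis compact_imp_closed in_closed_iff_infdist_zero infdist_nonneg less_eq_real_def)
      obtain N where N: "1 < real N * infdist (cis \<theta>) C"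
        using reals_Archimedean3[OF pos] by blast
      have "g k (cis \<theta>) = 0" if "k \<ge> N" for k
      proof -
        have "real N * infdist (cis \<theta>) C \<le> real k * infdist (cis \<theta>) C"
          using that pos by (intro mult_right_mono) auto
        then show ?thesis
          using N by (simp add: g_def)
      qed
      then have "\<forall>\<^sub>F k in sequentially. indicator {..c} \<theta> *\<^sub>R f \<theta> = of_real (g k (cis \<theta>)) * f \<theta>"
        using False by (auto simp: eventually_sequentially indicator_def)
      then show ?thesis
        by (rule Lim_transform_eventually[rotated]) simp
    qed
    have "(\<lambda>k. LINT \<theta>|circle. of_real (g k (cis \<theta>)) * f \<theta>)
        \<longlonglongrightarrow> (LINT \<theta>|circle. indicator {..c} \<theta> *\<^sub>R f \<theta>)"
    proof (rule integral_dominated_convergence[where w="\<lambda>\<theta>. cmod (f \<theta>)"])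
      show "AE \<theta> in circle. (\<lambda>k. of_real (g k (cis \<theta>)) * f \<theta>) \<longlonglongrightarrow> indicator {..c} \<theta> *\<^sub>R f \<theta>"
        using AE_circle by eventually_elim (rule lim)
      show "AE \<theta> in circle. norm (of_real (g k (cis \<theta>)) * f \<theta>) \<le> cmod (f \<theta>)" for k
        using g01[of k] by (intro AE_I2) (simp add: norm_mult mult_left_le_one_le)
    qed (use f(1) in auto)
    moreover have "(LINT \<theta>|circle. of_real (g k (cis \<theta>)) * f \<theta>) = 0" for k
      by (rule integral_continuous_eq_0[OF f g_cont])
    ultimately show ?thesis
      by (simp add: LIMSEQ_const_iff)
  qed
qed

text \<open>A Dynkin argument: half-lines are stable under intersection and generate the Borel sets,
  and the sets over which \<open>f\<close> integrates to 0 form a Dynkin class. Closure under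
  complement holds because coefficient 0 is the integral over the whole circle.\<close>

theorem fourier_eq_0_imp_AE_eq_0:
  assumes f: "integrable circle f" "\<And>n. fourier f n = 0"
  shows "AE \<theta> in circle. f \<theta> = 0"
proof (rule circle.density_zero[OF f(1)])
  define G where "G = range (\<lambda>a::real. {..a})"
  have sint: "set_integrable circle A f" if "A \<in> sets borel" for A
    unfolding set_integrable_def using f(1) that by (intro integrable_mult_indicator) auto
  fix A assume "A \<in> sets circle"
  then have A: "A \<in> sigma_sets UNIV G"
    unfolding sets_circle borel_eq_atMost G_def by simp
  have borel_G: "X \<in> sets borel" if "X \<in> sigma_sets UNIV G" for X
    using that unfolding borel_eq_atMost G_def by simp
  have "Int_stable G" "G \<subseteq> Pow UNIV"
    unfolding G_def by (auto simp: Int_stable_def)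
  then show "set_lebesgue_integral circle A f = 0"
    using A
  proof (induction A rule: sigma_sets_induct_disjoint)
    case (basic A)
    then show ?case
      unfolding G_def set_lebesgue_integral_def by (auto simp: integral_atMost_eq_0[OF f])
  next
    case (compl A)
    have "0 = (LINT \<theta>:UNIV|circle. f \<theta>)"
      using f(2)[of 0] by (simp add: fourier_def set_lebesgue_integral_def)
    also have "\<dots> = (LINT \<theta>:A \<union> (UNIV - A)|circle. f \<theta>)"
      by (simp add: Un_absorb1)
    also have "\<dots> = (LINT \<theta>:A|circle. f \<theta>) + (LINT \<theta>:UNIV - A|circle. f \<theta>)"
      using borel_G[OF compl(1)] by (intro set_integral_Un sint) auto
    finally show ?case
      using compl by simp
  next
    case (union A)
    have A: "A i \<in> sets borel" for i
      using union(2) borel_G by blast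
    have "(LINT \<theta>:\<Union> (range A)|circle. f \<theta>) = (\<Sum>i. (LINT \<theta>:(A i)|circle. f \<theta>))"
      using union(1) A
      by (intro lebesgue_integral_countable_add sint) (auto simp: disjoint_family_on_def)
    then show ?case
      using union by simp
  qed (simp add: set_lebesgue_integral_def)
qed

corollary fourier_eq_imp_AE_eq:
  assumes "integrable circle f" "integrable circle g" "\<And>n. fourier f n = fourier g n"
  shows "AE \<theta> in circle. f \<theta> = g \<theta>"
  using fourier_eq_0_imp_AE_eq_0[of "\<lambda>\<theta>. f \<theta> - g \<theta>"] assms by (simp add: fourier_diff)

subsection \<open>The Riesz--Fischer theorem and Parseval's identity\<close>

text \<open>Fatou's lemma for the squared moduli. In the Riesz-Fischer theorem it serves twice, for
  the limit itself and for its distance to a partial sum, and so stands in for completeness of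
  \<open>L2\<close>.\<close>

lemma L2_fatou:
  assumes g: "\<And>k. g k \<in> L2" and bound: "\<And>k. (L2_norm (g k))\<^sup>2 \<le> C"
    and f [measurable]: "f \<in> borel_measurable borel"
    and lim: "AE \<theta> in circle. (\<lambda>k. g k \<theta>) \<longlonglongrightarrow> f \<theta>"
  shows "f \<in> L2 \<and> (L2_norm f)\<^sup>2 \<le> C"
proof -
  have [measurable]: "g k \<in> borel_measurable borel" for k
    using g by (rule L2_measurable)
  have C: "0 \<le> C"
    using bound[of 0] by (rule order_trans[rotated]) simp
  have "(\<integral>\<^sup>+\<theta>. ennreal ((cmod (f \<theta>))\<^sup>2) \<partial>circle)
      = (\<integral>\<^sup>+\<theta>. liminf (\<lambda>k. ennreal ((cmod (g k \<theta>))\<^sup>2)) \<partial>circle)"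
  proof (rule nn_integral_cong_AE)
    show "AE \<theta> in circle. ennreal ((cmod (f \<theta>))\<^sup>2) = liminf (\<lambda>k. ennreal ((cmod (g k \<theta>))\<^sup>2))"
      using lim
    proof eventually_elim
      case (elim \<theta>)
      then have "(\<lambda>k. ennreal ((cmod (g k \<theta>))\<^sup>2)) \<longlonglongrightarrow> ennreal ((cmod (f \<theta>))\<^sup>2)"
        by (intro tendsto_ennrealI tendsto_intros)
      then show ?case
        by (intro lim_imp_Liminf[symmetric]) simp_all
    qed
  qed
  also have "\<dots> \<le> liminf (\<lambda>k. \<integral>\<^sup>+\<theta>. ennreal ((cmod (g k \<theta>))\<^sup>2) \<partial>circle)"
    by (rule nn_integral_liminf) simp
  also have "\<dots> \<le> liminf (\<lambda>k::nat. ennreal C)"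
  proof (rule Liminf_mono, rule always_eventually, rule allI)
    fix k
    have "(\<integral>\<^sup>+\<theta>. ennreal ((cmod (g k \<theta>))\<^sup>2) \<partial>circle) = ennreal ((L2_norm (g k))\<^sup>2)"
      unfolding L2_norm_sq by (rule nn_integral_eq_integral) (use L2_integrable_sq[OF g] in auto)
    then show "(\<integral>\<^sup>+\<theta>. ennreal ((cmod (g k \<theta>))\<^sup>2) \<partial>circle) \<le> ennreal C"
      using bound by (simp add: ennreal_leI)
  qed
  also have "\<dots> = ennreal C"
    by (simp add: Liminf_const)
  finally have le: "(\<integral>\<^sup>+\<theta>. ennreal ((cmod (f \<theta>))\<^sup>2) \<partial>circle) \<le> ennreal C" .
  then have int: "integrable circle (\<lambda>\<theta>. (cmod (f \<theta>))\<^sup>2)"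
    by (intro integrableI_bounded) (auto simp: le_less_trans)
  have "ennreal ((L2_norm f)\<^sup>2) \<le> ennreal C"
    unfolding L2_norm_sq by (subst nn_integral_eq_integral[symmetric, OF int]) (use le in auto)
  then show ?thesis
    using C int by (auto intro: L2_I)
qed

lemma square_summable_tail:
  fixes b :: "'a \<Rightarrow> real"
  assumes "b summable_on UNIV" "\<And>n. b n \<ge> 0" "e > 0"
  obtains F where "finite F" "\<And>G. finite G \<Longrightarrow> G \<inter> F = {} \<Longrightarrow> sum b G \<le> e"
proof -
  obtain F where F: "finite F" "dist (sum b F) (infsum b UNIV) \<le> e"
    using has_sum_finite_approximation[OF has_sum_infsum[OF assms(1)] assms(3)] by auto
  have "sum b G \<le> e" if "finite G" "G \<inter> F = {}" for G
  proof -
    have "sum b G + sum b F = sum b (G \<union> F)"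
      using that F(1) by (simp add: sum.union_disjoint)
    also have "\<dots> \<le> infsum b UNIV"
      using that F(1) assms by (intro finite_sum_le_infsum) auto
    finally show ?thesis
      using F(2) by (simp add: dist_real_def)
  qed
  with F(1) that show ?thesis by blast
qed

lemma trig_poly_diff:
  assumes "finite G" "F \<subseteq> G"
  shows "(\<lambda>\<theta>. trig_poly G a \<theta> - trig_poly F a \<theta>) = trig_poly (G - F) a"
  using assms by (auto simp: trig_poly_def fun_eq_iff sum_diff)

text \<open>On a space of mass 1 the \<open>L1\<close> norm is at most the \<open>L2\<close> norm,
  so the sum of the moduli has a finite integral and is finite almost everywhere.\<close>

lemma AE_summable_of_L2_norm:
  assumes d: "\<And>k. d k \<in> L2" and "\<And>k. L2_norm (d k) \<le> e k" and e: "summable e"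
  shows "AE \<theta> in circle. summable (\<lambda>k. cmod (d k \<theta>))"
proof -
  have [measurable]: "d k \<in> borel_measurable borel" for k
    using d by (rule L2_measurable)
  have e0: "0 \<le> e k" for k
    using assms(2)[of k] by (rule order_trans[rotated]) simp
  have "(\<integral>\<^sup>+\<theta>. (\<Sum>k. ennreal (cmod (d k \<theta>))) \<partial>circle) = (\<Sum>k. \<integral>\<^sup>+\<theta>. ennreal (cmod (d k \<theta>)) \<partial>circle)"
    by (rule nn_integral_suminf) simp
  also have "\<dots> = (\<Sum>k. ennreal (LINT \<theta>|circle. cmod (d k \<theta>)))"
    by (intro arg_cong[where f=suminf] ext nn_integral_eq_integral) (use L2_integrable[OF d] in auto)
  also have "\<dots> \<le> (\<Sum>k. ennreal (e k))"
    by (intro suminf_le ennreal_leI order_trans[OF integral_norm_le_L2_norm[OF d] assms(2)]) auto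
  also have "\<dots> = ennreal (\<Sum>k. e k)"
    using e e0 by (intro suminf_ennreal2) auto
  finally have "(\<integral>\<^sup>+\<theta>. (\<Sum>k. ennreal (cmod (d k \<theta>))) \<partial>circle) \<noteq> \<infinity>"
    by (auto simp: top_unique)
  then have "AE \<theta> in circle. (\<Sum>k. ennreal (cmod (d k \<theta>))) \<noteq> \<infinity>"
    by (intro nn_integral_noteq_infinite) simp_all
  then show ?thesis
    by eventually_elim (rule summable_suminf_not_top, auto)
qed

text \<open>Partial sums over growing finite sets of frequencies converge almost everywhere once the
  tails decay geometrically. The limit is built pointwise; Fatou supplies its norm and its distance
  to the partial sums, and this distance determines its coefficients.\<close>

theorem riesz_fischer:
  assumes a: "(\<lambda>n::int. (cmod (a n))\<^sup>2) summable_on UNIV"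
  obtains f where "f \<in> L2" "\<And>n. fourier f n = a n" "(L2_norm f)\<^sup>2 \<le> (\<Sum>\<^sub>\<infinity>n. (cmod (a n))\<^sup>2)"
proof -
  define b where "b n = (cmod (a n))\<^sup>2" for n
  have b: "b summable_on UNIV" "b n \<ge> 0" for n
    using a unfolding b_def by auto
  \<comment> \<open>The bound \<open>(1 / 4) ^ k\<close> is for squared norms, so the increments
    have norms at most \<open>(1 / 2) ^ k\<close>, which are summable.\<close>
  have "\<exists>F. finite F \<and> (\<forall>G. finite G \<longrightarrow> G \<inter> F = {} \<longrightarrow> sum b G \<le> (1 / 4) ^ k)" for k :: nat
    by (rule square_summable_tail[OF b, of "(1 / 4) ^ k"]) (simp, blast)
  then obtain F0 :: "nat \<Rightarrow> int set" where F0: "\<And>k. finite (F0 k)"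
    "\<And>k G. finite G \<Longrightarrow> G \<inter> F0 k = {} \<Longrightarrow> sum b G \<le> (1 / 4) ^ k"
    by metis
  \<comment> \<open>The sets \<open>F0 k\<close> need not be nested; their unions are, so a
    difference of partial sums is a sum over \<open>F k - F j\<close>.\<close>
  define F where "F k = (\<Union>i\<le>k. F0 i)" for k
  have F: "finite (F k)" "F0 k \<subseteq> F k" for k
    unfolding F_def using F0(1) by auto
  have F_mono: "F j \<subseteq> F k" if "j \<le> k" for j k
    unfolding F_def using that by force
  have tail: "sum b G \<le> (1 / 4) ^ k" if "finite G" "G \<inter> F k = {}" for G k
    using F0(2)[of G k] F(2)[of k] that by blast
  define P where "P k = trig_poly (F k) a" for k
  have P: "P k \<in> L2" for k
    unfolding P_def by (rule trig_poly_L2)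
  have norm_diff: "(L2_norm (\<lambda>\<theta>. P k \<theta> - P j \<theta>))\<^sup>2 \<le> (1 / 4) ^ j" if "j \<le> k" for j k
    unfolding P_def trig_poly_diff[OF F(1) F_mono[OF that]]
    using tail[of "F k - F j" j] F(1) by (subst L2_norm_trig_poly) (auto simp: b_def)
  define d where "d k \<theta> = P (Suc k) \<theta> - P k \<theta>" for k \<theta>
  have d: "d k \<in> L2" for k
    unfolding d_def[abs_def] by (intro L2_diff P)
  have d_norm: "L2_norm (d k) \<le> (1 / 2) ^ k" for k
  proof (rule power2_le_imp_le)
    show "(L2_norm (d k))\<^sup>2 \<le> ((1 / 2) ^ k)\<^sup>2"
      using norm_diff[of k "Suc k"] unfolding d_def[abs_def]
      by (simp add: power2_eq_square flip: power_mult_distrib)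
  qed simp
  have ae: "AE \<theta> in circle. summable (\<lambda>k. cmod (d k \<theta>))"
    by (rule AE_summable_of_L2_norm[OF d d_norm]) (simp add: summable_geometric)
  \<comment> \<open>A telescoping series. Where it diverges, \<open>suminf\<close> has an
    unspecified value, but by \<open>ae\<close> this affects a null set only.\<close>
  define f where "f \<theta> = P 0 \<theta> + (\<Sum>k. d k \<theta>)" for \<theta>
  have [measurable]: "P k \<in> borel_measurable borel" "d k \<in> borel_measurable borel" for k
    using P d by (auto intro: L2_measurable)
  have f_meas [measurable]: "f \<in> borel_measurable borel"
    unfolding f_def[abs_def] by measurable
  have lim: "AE \<theta> in circle. (\<lambda>k. P k \<theta>) \<longlonglongrightarrow> f \<theta>"
    using ae
  proof eventually_elim
    case (elim \<theta>)
    have "(\<lambda>k. P 0 \<theta> + (\<Sum>i<k. d i \<theta>)) \<longlonglongrightarrow> f \<theta>"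
      unfolding f_def by (intro tendsto_add tendsto_const summable_LIMSEQ summable_norm_cancel[OF elim])
    moreover have "P 0 \<theta> + (\<Sum>i<k. d i \<theta>) = P k \<theta>" for k
      unfolding d_def by (subst sum_lessThan_telescope) simp
    ultimately show ?case by simp
  qed
  have "f \<in> L2 \<and> (L2_norm f)\<^sup>2 \<le> (\<Sum>\<^sub>\<infinity>n. (cmod (a n))\<^sup>2)"
  proof (rule L2_fatou[OF P _ f_meas lim])
    show "(L2_norm (P k))\<^sup>2 \<le> (\<Sum>\<^sub>\<infinity>n. (cmod (a n))\<^sup>2)" for k
      unfolding P_def using F(1) a
      by (subst L2_norm_trig_poly) (auto intro!: finite_sum_le_infsum)
  qed
  moreover have "fourier f n = a n" if f: "f \<in> L2" for n
  proof -
    have le: "cmod (fourier f n - a n) \<le> 2 * (1 / 2) ^ j" for j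
    proof -
      have "(\<lambda>\<theta>. f \<theta> - P j \<theta>) \<in> L2 \<and> (L2_norm (\<lambda>\<theta>. f \<theta> - P j \<theta>))\<^sup>2 \<le> (1 / 4) ^ j"
      proof (rule L2_fatou[where g="\<lambda>k \<theta>. P (k + j) \<theta> - P j \<theta>"])
        show "AE \<theta> in circle. (\<lambda>k. P (k + j) \<theta> - P j \<theta>) \<longlonglongrightarrow> f \<theta> - P j \<theta>"
          using lim by eventually_elim (intro tendsto_diff tendsto_const LIMSEQ_ignore_initial_segment)
      qed (auto intro!: L2_diff P norm_diff)
      then have "(\<lambda>\<theta>. f \<theta> - P j \<theta>) \<in> L2"
        and "(L2_norm (\<lambda>\<theta>. f \<theta> - P j \<theta>))\<^sup>2 \<le> ((1 / 2) ^ j)\<^sup>2"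
        by (auto simp: power2_eq_square simp flip: power_mult_distrib)
      then have "cmod (fourier (\<lambda>\<theta>. f \<theta> - P j \<theta>) n) \<le> (1 / 2) ^ j"
        by (meson cmod_fourier_le order_trans power2_le_imp_le zero_le_divide_1_iff zero_le_numeral zero_le_power)
      then have 1: "cmod (fourier f n - fourier (P j) n) \<le> (1 / 2) ^ j"
        using f P by (simp add: fourier_diff L2_integrable)
      \<comment> \<open>At a frequency outside \<open>F j\<close> the partial sum has coefficient 0,
        and \<open>a n\<close> alone counts as a tail beyond \<open>F j\<close>.\<close>
      have 2: "cmod (fourier (P j) n - a n) \<le> (1 / 2) ^ j"
      proof (cases "n \<in> F j")
        case False
        then have "(cmod (a n))\<^sup>2 \<le> ((1 / 2) ^ j)\<^sup>2"
          using tail[of "{n}" j] by (simp add: b_def power2_eq_square flip: power_mult_distrib)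
        then have "cmod (a n) \<le> (1 / 2) ^ j"
          by (rule power2_le_imp_le) simp
        then show ?thesis
          using False F(1) by (simp add: P_def fourier_trig_poly)
      qed (use F(1) in \<open>simp add: P_def fourier_trig_poly\<close>)
      have "fourier f n - a n = (fourier f n - fourier (P j) n) + (fourier (P j) n - a n)"
        by simp
      then show ?thesis
        using norm_triangle_mono[OF 1 2] by simp
    qed
    have "(\<lambda>j::nat. 2 * (1 / 2 :: real) ^ j) \<longlonglongrightarrow> 2 * 0"
      by (intro tendsto_intros LIMSEQ_power_zero) simp
    then have "cmod (fourier f n - a n) \<le> 2 * 0"
      by (rule LIMSEQ_le_const) (use le in blast)
    then show ?thesis by simp
  qed
  ultimately show ?thesis
    using that by blast
qed

lemma fourier_sq_summable:
  assumes "f \<in> L2"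
  shows "(\<lambda>n. (cmod (fourier f n))\<^sup>2) summable_on UNIV"
    and "(\<Sum>\<^sub>\<infinity>n. (cmod (fourier f n))\<^sup>2) \<le> (L2_norm f)\<^sup>2"
proof -
  show "(\<lambda>n. (cmod (fourier f n))\<^sup>2) summable_on UNIV"
    by (rule nonneg_bdd_above_summable_on) (auto intro!: bdd_aboveI2 bessel[OF assms])
  then show "(\<Sum>\<^sub>\<infinity>n. (cmod (fourier f n))\<^sup>2) \<le> (L2_norm f)\<^sup>2"
    by (rule infsum_le_finite_sums) (rule bessel[OF assms])
qed

lemma L2_norm_cong_AE:
  assumes "f \<in> borel_measurable borel" "g \<in> borel_measurable borel"
    and "AE \<theta> in circle. f \<theta> = g \<theta>"
  shows "L2_norm f = L2_norm g"
  unfolding L2_norm_def using assms(3)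
  by (intro arg_cong[where f=sqrt] integral_cong_AE)
     (use assms(1,2) in \<open>auto elim!: eventually_mono\<close>)

text \<open>Bessel gives one inequality. For the other, the function that Riesz-Fischer builds from
  the coefficients of \<open>f\<close> satisfies it by construction and equals \<open>f\<close>
  almost everywhere by completeness.\<close>

theorem parseval:
  assumes "f \<in> L2"
  shows "(L2_norm f)\<^sup>2 = (\<Sum>\<^sub>\<infinity>n. (cmod (fourier f n))\<^sup>2)"
proof (rule antisym)
  obtain g where g: "g \<in> L2" "\<And>n. fourier g n = fourier f n"
    "(L2_norm g)\<^sup>2 \<le> (\<Sum>\<^sub>\<infinity>n. (cmod (fourier f n))\<^sup>2)"
    using riesz_fischer[OF fourier_sq_summable(1)[OF assms]] by blast
  have "AE \<theta> in circle. f \<theta> = g \<theta>"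
    using assms g by (intro fourier_eq_imp_AE_eq L2_integrable) auto
  then have "L2_norm f = L2_norm g"
    using assms g(1) by (intro L2_norm_cong_AE L2_measurable)
  then show "(L2_norm f)\<^sup>2 \<le> (\<Sum>\<^sub>\<infinity>n. (cmod (fourier f n))\<^sup>2)"
    using g(3) by simp
qed (rule fourier_sq_summable(2)[OF assms])

subsection \<open>The Szego projector and the shifts\<close>

lemma fourier_series_spec:
  assumes "(\<lambda>n. (cmod (a n))\<^sup>2) summable_on UNIV"
  shows fourier_series_L2: "fourier_series a \<in> L2"
    and fourier_fourier_series: "fourier (fourier_series a) n = a n"
proof -
  have "\<exists>f. f \<in> L2 \<and> (\<forall>n. fourier f n = a n)"
    using riesz_fischer[OF assms] by metis
  then have "fourier_series a \<in> L2 \<and> (\<forall>n. fourier (fourier_series a) n = a n)"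
    unfolding fourier_series_def by (rule someI_ex)
  then show "fourier_series a \<in> L2" "fourier (fourier_series a) n = a n"
    by auto
qed

text \<open>Projection, shifts, conjugation and the truncation in Hankel operators delete some
  coefficients and move the rest injectively. This comparison serves them all, with squared moduli
  for \<open>L2\<close> and with moduli for the Wiener norm.\<close>

lemma summable_on_dominated_reindex:
  fixes f g :: "int \<Rightarrow> real"
  assumes f: "f summable_on UNIV" and \<phi>: "inj \<phi>"
    and g: "\<And>n. 0 \<le> g n" "\<And>n. g n \<le> f (\<phi> n)" and f0: "\<And>n. 0 \<le> f n"
  shows "g summable_on UNIV" "infsum g UNIV \<le> infsum f UNIV"
proof -
  have f_range: "f summable_on range \<phi>"
    by (rule summable_on_subset_banach[OF f]) simp
  then have f\<phi>: "(\<lambda>n. f (\<phi> n)) summable_on UNIV"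
    using summable_on_reindex[OF \<phi>, of f] by (simp add: o_def)
  show *: "g summable_on UNIV"
    by (rule summable_on_comparison_test[OF f\<phi>]) (use g in auto)
  have "infsum g UNIV \<le> infsum (\<lambda>n. f (\<phi> n)) UNIV"
    by (rule infsum_mono[OF * f\<phi>]) (use g in auto)
  also have "\<dots> = infsum f (range \<phi>)"
    using infsum_reindex[OF \<phi>, of f] by (simp add: o_def)
  also have "\<dots> \<le> infsum f UNIV"
    by (rule infsum_mono2[OF f_range f]) (use f0 in auto)
  finally show "infsum g UNIV \<le> infsum f UNIV" .
qed

lemma L2_norm_dominated_reindex:
  assumes "f \<in> L2" "g \<in> L2" "inj \<phi>" "\<And>n. cmod (fourier g n) \<le> cmod (fourier f (\<phi> n))"
  shows "L2_norm g \<le> L2_norm f"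
proof (rule power2_le_imp_le)
  show "(L2_norm g)\<^sup>2 \<le> (L2_norm f)\<^sup>2"
    unfolding parseval[OF assms(1)] parseval[OF assms(2)]
    by (rule summable_on_dominated_reindex(2)[OF fourier_sq_summable(1)[OF assms(1)] assms(3)])
       (use assms(4) in \<open>auto intro: power_mono\<close>)
qed simp

lemma szego_proj:
  assumes "f \<in> L2"
  shows szego_proj_L2: "szego_proj f \<in> L2"
    and fourier_szego_proj: "fourier (szego_proj f) n = (if n \<ge> 0 then fourier f n else 0)"
proof -
  have "(\<lambda>n. (cmod (if n \<ge> 0 then fourier f n else 0))\<^sup>2) summable_on UNIV"
    by (rule summable_on_dominated_reindex(1)[OF fourier_sq_summable(1)[OF assms], of id]) auto
  from fourier_series_spec[OF this]
  show "szego_proj f \<in> L2" "fourier (szego_proj f) n = (if n \<ge> 0 then fourier f n else 0)"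
    unfolding szego_proj_def by auto
qed

lemma shift_adj:
  assumes "f \<in> L2"
  shows shift_adj_L2: "shift_adj f \<in> L2"
    and fourier_shift_adj: "fourier (shift_adj f) n = (if n \<ge> 0 then fourier f (n + 1) else 0)"
proof -
  have "(\<lambda>n. (cmod (if n \<ge> 0 then fourier f (n + 1) else 0))\<^sup>2) summable_on UNIV"
    by (rule summable_on_dominated_reindex(1)[OF fourier_sq_summable(1)[OF assms], of "\<lambda>n. n + 1"])
       (auto simp: inj_def)
  from fourier_series_spec[OF this]
  show "shift_adj f \<in> L2" "fourier (shift_adj f) n = (if n \<ge> 0 then fourier f (n + 1) else 0)"
    unfolding shift_adj_def by auto
qed

lemma shift_eq: "shift f = (\<lambda>\<theta>. cis (of_int 1 * \<theta>) * f \<theta>)"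
  by (simp add: shift_def)

lemma shift_L2: "f \<in> L2 \<Longrightarrow> shift f \<in> L2"
  unfolding shift_eq by (rule L2_mult_cis)

lemma fourier_shift: "fourier (shift f) n = fourier f (n - 1)"
  unfolding shift_eq by (rule fourier_mult_cis)

lemma L2_plus_iff: "h \<in> L2_plus \<longleftrightarrow> h \<in> L2 \<and> (\<forall>n<0. fourier h n = 0)"
  by (simp add: L2_plus_def)

lemma szego_proj_L2_plus: "f \<in> L2 \<Longrightarrow> szego_proj f \<in> L2_plus"
  by (simp add: L2_plus_iff szego_proj_L2 fourier_szego_proj)

lemma shift_adj_L2_plus: "f \<in> L2 \<Longrightarrow> shift_adj f \<in> L2_plus"
  by (simp add: L2_plus_iff shift_adj_L2 fourier_shift_adj)

subsection \<open>The Wiener algebra\<close>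

text \<open>Summability of the coefficients says nothing by itself: for a non-integrable function
  every integral in \<open>fourier\<close> defaults to 0. Membership in \<open>L2\<close> rules this
  out.\<close>

definition wiener :: "(real \<Rightarrow> complex) set" where
  "wiener = {f \<in> L2. (\<lambda>n. cmod (fourier f n)) summable_on UNIV}"

definition wiener_norm :: "(real \<Rightarrow> complex) \<Rightarrow> real" where
  "wiener_norm f = (\<Sum>\<^sub>\<infinity>n. cmod (fourier f n))"

lemma wiener_L2: "f \<in> wiener \<Longrightarrow> f \<in> L2"
  by (simp add: wiener_def)

lemma wiener_summable: "f \<in> wiener \<Longrightarrow> (\<lambda>n. cmod (fourier f n)) summable_on UNIV"
  by (simp add: wiener_def)

lemma wiener_norm_nonneg [simp]: "0 \<le> wiener_norm f"
  unfolding wiener_norm_def by (rule infsum_nonneg) simp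

lemma wiener_dominated_reindex:
  assumes "f \<in> wiener" "g \<in> L2" "inj \<phi>" "\<And>n. cmod (fourier g n) \<le> cmod (fourier f (\<phi> n))"
  shows "g \<in> wiener" "wiener_norm g \<le> wiener_norm f"
  using summable_on_dominated_reindex[OF wiener_summable[OF assms(1)] assms(3), of "\<lambda>n. cmod (fourier g n)"]
    assms(2,4) by (auto simp: wiener_def wiener_norm_def)

text \<open>Termwise integration and measurability are applied to series over \<open>nat\<close>;
  the enumeration \<open>int_decode\<close> carries sums over the integers there, and absolute
  convergence makes its order immaterial.\<close>

lemma summable_int_decode:
  fixes f :: "int \<Rightarrow> 'a::banach"
  assumes "(\<lambda>n. norm (f n)) summable_on UNIV"
  shows "summable (\<lambda>k. norm (f (int_decode k)))"
    and "(\<Sum>\<^sub>\<infinity>n. f n) = (\<Sum>k. f (int_decode k))"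
proof -
  have bij: "bij_betw int_decode UNIV UNIV"
    by (rule bij_int_decode)
  have *: "(\<lambda>k. norm (f (int_decode k))) summable_on UNIV"
    using summable_on_reindex_bij_betw[OF bij, of "\<lambda>n. norm (f n)"] assms by simp
  then show "summable (\<lambda>k. norm (f (int_decode k)))"
    by (rule summable_on_imp_summable)
  have "(\<lambda>k. f (int_decode k)) summable_on UNIV"
    using * by (rule abs_summable_summable)
  then have "((\<lambda>k. f (int_decode k)) has_sum infsum (\<lambda>k. f (int_decode k)) UNIV) UNIV"
    by simp
  then have "(\<Sum>k. f (int_decode k)) = infsum (\<lambda>k. f (int_decode k)) UNIV"
    by (intro sums_unique[symmetric] has_sum_imp_sums)
  then show "(\<Sum>\<^sub>\<infinity>n. f n) = (\<Sum>k. f (int_decode k))"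
    using infsum_reindex_bij_betw[OF bij, of f] by simp
qed

section \<open>Sums of absolutely convergent Fourier series\<close>

definition abs_conv_series :: "(int \<Rightarrow> complex) \<Rightarrow> real \<Rightarrow> complex" where
  "abs_conv_series c \<theta> = (\<Sum>\<^sub>\<infinity>n. c n * cis (of_int n * \<theta>))"

context
  fixes c :: "int \<Rightarrow> complex"
  assumes c: "(\<lambda>n. cmod (c n)) summable_on UNIV"
begin

lemma abs_conv_series_suminf:
  "abs_conv_series c \<theta> = (\<Sum>k. c (int_decode k) * cis (of_int (int_decode k) * \<theta>))"
  unfolding abs_conv_series_def
  by (rule summable_int_decode(2)) (simp add: norm_mult c)

lemma abs_conv_series_measurable: "abs_conv_series c \<in> borel_measurable borel"
  unfolding abs_conv_series_suminf[abs_def] by measurable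

lemma cmod_abs_conv_series_le: "cmod (abs_conv_series c \<theta>) \<le> (\<Sum>\<^sub>\<infinity>n. cmod (c n))"
  unfolding abs_conv_series_def
  by (rule order_trans[OF norm_infsum_bound]) (simp_all add: norm_mult c)

text \<open>Termwise integration: the terms have \<open>L1\<close> norms
  \<open>cmod (c k) * M\<close>, which are summable. The convolution on the right converges because
  \<open>M\<close> bounds the coefficients of \<open>h\<close>. The choice \<open>h = 1\<close> will
  recover \<open>c\<close>.\<close>

lemma fourier_abs_conv_series_mult:
  assumes h: "integrable circle h"
  shows "fourier (\<lambda>\<theta>. abs_conv_series c \<theta> * h \<theta>) n = (\<Sum>\<^sub>\<infinity>k. c k * fourier h (n - k))"
proof -
  define M where "M = (LINT \<theta>|circle. cmod (h \<theta>))"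
  have bound: "cmod (fourier h k) \<le> M" for k
    unfolding fourier_def M_def by (rule order_trans[OF integral_norm_bound]) (simp add: norm_mult)
  define F where "F k \<theta> = c k * (h \<theta> * cis (- (of_int (n - k) * \<theta>)))" for k \<theta>
  have F_eq: "c k * cis (of_int k * \<theta>) * h \<theta> * cis (- (of_int n * \<theta>)) = F k \<theta>" for k \<theta>
  proof -
    have "c k * cis (of_int k * \<theta>) * h \<theta> * cis (- (of_int n * \<theta>))
        = c k * (h \<theta> * (cis (of_int k * \<theta>) * cis (- (of_int n * \<theta>))))"
      by (simp only: mult_ac)
    also have "cis (of_int k * \<theta>) * cis (- (of_int n * \<theta>)) = cis (- (of_int (n - k) * \<theta>))"
      by (simp add: cis_mult algebra_simps)
    finally show ?thesis by (simp add: F_def)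
  qed
  have intF: "integrable circle (F k)" for k
    unfolding F_def[abs_def]
    by (intro Bochner_Integration.integrable_mult_right integrable_mult_cis_minus h)
  have normF: "cmod (F k \<theta>) = cmod (c k) * cmod (h \<theta>)" for k \<theta>
    by (simp add: F_def norm_mult)
  note c_sum = summable_int_decode(1)[OF c]
  have sum: "summable (\<lambda>k. cmod (F (int_decode k) \<theta>))" for \<theta>
    unfolding normF by (rule summable_mult2[OF c_sum])
  have "abs_conv_series c \<theta> * h \<theta> * cis (- (of_int n * \<theta>)) = (\<Sum>k. F (int_decode k) \<theta>)" for \<theta>
  proof -
    have s: "summable (\<lambda>k. c (int_decode k) * cis (of_int (int_decode k) * \<theta>))"
      by (rule summable_norm_cancel) (simp add: norm_mult c_sum)
    show ?thesis
      unfolding abs_conv_series_suminf F_eq[symmetric]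
      by (simp add: suminf_mult2[OF s] suminf_mult2[OF summable_mult2[OF s]])
  qed
  then have "fourier (\<lambda>\<theta>. abs_conv_series c \<theta> * h \<theta>) n = (LINT \<theta>|circle. (\<Sum>k. F (int_decode k) \<theta>))"
    unfolding fourier_def by simp
  also have "\<dots> = (\<Sum>k. LINT \<theta>|circle. F (int_decode k) \<theta>)"
  proof (rule integral_suminf[OF intF])
    show "AE \<theta> in circle. summable (\<lambda>k. norm (F (int_decode k) \<theta>))"
      using sum by simp
    have "(LINT \<theta>|circle. norm (F k \<theta>)) = cmod (c k) * M" for k
      unfolding normF M_def by simp
    then show "summable (\<lambda>k. LINT \<theta>|circle. norm (F (int_decode k) \<theta>))"
      by (simp add: summable_mult2[OF c_sum])
  qed
  also have "\<dots> = (\<Sum>k. c (int_decode k) * fourier h (n - int_decode k))"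
    unfolding F_def fourier_def by simp
  also have "\<dots> = (\<Sum>\<^sub>\<infinity>k. c k * fourier h (n - k))"
  proof (rule summable_int_decode(2)[symmetric])
    show "(\<lambda>k. norm (c k * fourier h (n - k))) summable_on UNIV"
      by (rule summable_on_comparison_test[OF summable_on_cmult_left[OF c, of M]])
         (auto simp: norm_mult intro!: mult_left_mono bound)
  qed
  finally show ?thesis .
qed

lemma fourier_abs_conv_series: "fourier (abs_conv_series c) n = c n"
proof -
  have "fourier (\<lambda>\<theta>. abs_conv_series c \<theta> * 1) n = (\<Sum>\<^sub>\<infinity>k. c k * fourier (\<lambda>_. 1) (n - k))"
    by (rule fourier_abs_conv_series_mult) (rule L2_integrable[OF L2_const])
  also have "\<dots> = (\<Sum>\<^sub>\<infinity>k\<in>{n}. c k * fourier (\<lambda>_. 1) (n - k))"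
    using fourier_cis[of 0] by (intro infsum_cong_neutral) auto
  also have "\<dots> = c n"
    using fourier_cis[of 0 0] by simp
  finally show ?thesis by simp
qed

end

lemma wiener_AE_eq_series:
  assumes "f \<in> wiener"
  shows "AE \<theta> in circle. f \<theta> = abs_conv_series (fourier f) \<theta>"
proof (rule fourier_eq_imp_AE_eq)
  note c = wiener_summable[OF assms]
  show "integrable circle (abs_conv_series (fourier f))"
    using abs_conv_series_measurable[OF c] cmod_abs_conv_series_le[OF c]
    by (intro L2_integrable L2_bounded AE_I2)
qed (use assms in \<open>simp_all add: wiener_L2 L2_integrable fourier_abs_conv_series wiener_summable\<close>)

section \<open>Multiplication by Wiener functions, on \<open>L2\<close> and within the Wiener
  algebra\<close>

lemma wiener_bounded:
  assumes "f \<in> wiener"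
  shows "AE \<theta> in circle. cmod (f \<theta>) \<le> wiener_norm f"
  using wiener_AE_eq_series[OF assms]
  by eventually_elim (simp add: wiener_norm_def cmod_abs_conv_series_le wiener_summable assms)

lemma wiener_mult_L2: "f \<in> wiener \<Longrightarrow> h \<in> L2 \<Longrightarrow> (\<lambda>\<theta>. f \<theta> * h \<theta>) \<in> L2"
  using wiener_bounded by (blast intro: L2_mult_bounded L2_measurable wiener_L2)

text \<open>Hankel operators are truncations of such products, so this estimate is what makes the
  Wiener norm of the symbol dominate their operator norm.\<close>

lemma L2_norm_wiener_mult_le:
  assumes "f \<in> wiener" "h \<in> L2"
  shows "L2_norm (\<lambda>\<theta>. f \<theta> * h \<theta>) \<le> wiener_norm f * L2_norm h"
proof (rule power2_le_imp_le)
  have "(LINT \<theta>|circle. (cmod (f \<theta> * h \<theta>))\<^sup>2) \<le> (LINT \<theta>|circle. (wiener_norm f)\<^sup>2 * (cmod (h \<theta>))\<^sup>2)"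
  proof (rule integral_mono_AE)
    show "AE \<theta> in circle. (cmod (f \<theta> * h \<theta>))\<^sup>2 \<le> (wiener_norm f)\<^sup>2 * (cmod (h \<theta>))\<^sup>2"
      using wiener_bounded[OF assms(1)]
      by eventually_elim (simp add: norm_mult power_mult_distrib mult_right_mono power_mono)
  qed (use assms in \<open>auto intro: L2_integrable_sq wiener_mult_L2\<close>)
  then show "(L2_norm (\<lambda>\<theta>. f \<theta> * h \<theta>))\<^sup>2 \<le> (wiener_norm f * L2_norm h)\<^sup>2"
    by (simp add: L2_norm_sq power_mult_distrib)
qed simp

lemma fourier_wiener_mult:
  assumes "f \<in> wiener" "h \<in> L2"
  shows "fourier (\<lambda>\<theta>. f \<theta> * h \<theta>) n = (\<Sum>\<^sub>\<infinity>k. fourier f k * fourier h (n - k))"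
proof -
  note c = wiener_summable[OF assms(1)]
  have [measurable]: "f \<in> borel_measurable borel" "h \<in> borel_measurable borel"
    "abs_conv_series (fourier f) \<in> borel_measurable borel"
    using assms abs_conv_series_measurable[OF c] by (auto intro: L2_measurable wiener_L2)
  have "fourier (\<lambda>\<theta>. f \<theta> * h \<theta>) = fourier (\<lambda>\<theta>. abs_conv_series (fourier f) \<theta> * h \<theta>)"
  proof (rule fourier_cong_AE)
    show "AE \<theta> in circle. f \<theta> * h \<theta> = abs_conv_series (fourier f) \<theta> * h \<theta>"
      using wiener_AE_eq_series[OF assms(1)] by eventually_elim simp
  qed measurable
  then show ?thesis
    using fourier_abs_conv_series_mult[OF c L2_integrable[OF assms(2)]] by simp
qed

text \<open>Young's inequality for the convolution of two \<open>l1\<close> sequences: the double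
  family \<open>F k n\<close> is summed over \<open>n\<close> first, where translation invariance
  gives \<open>wiener_norm g\<close>, and then the order is interchanged.\<close>

lemma wiener_mult:
  assumes f: "f \<in> wiener" and g: "g \<in> wiener"
  shows "(\<lambda>\<theta>. f \<theta> * g \<theta>) \<in> wiener"
    and "wiener_norm (\<lambda>\<theta>. f \<theta> * g \<theta>) \<le> wiener_norm f * wiener_norm g"
proof -
  define F where "F k n = cmod (fourier f k) * cmod (fourier g (n - k))" for k n
  have F_nonneg: "0 \<le> F k n" for k n
    by (simp add: F_def)
  have bij: "bij_betw (\<lambda>n::int. n - k) UNIV UNIV" for k
    by (rule bij_betwI[where g="\<lambda>n. n + k"]) auto
  have "((\<lambda>n. cmod (fourier g (n - k))) has_sum wiener_norm g) UNIV" for k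
    using has_sum_reindex_bij_betw[OF bij, of "\<lambda>n. cmod (fourier g n)"] wiener_summable[OF g]
    by (simp add: wiener_norm_def)
  then have F_sum: "(F k has_sum cmod (fourier f k) * wiener_norm g) UNIV" for k
    unfolding F_def[abs_def] by (rule has_sum_cmult_right)
  have F2: "(\<lambda>(k, n). F k n) summable_on UNIV \<times> UNIV"
    by (intro summable_on_SigmaI[where g="\<lambda>k. cmod (fourier f k) * wiener_norm g"]
        summable_on_cmult_left wiener_summable f) (auto simp: F_nonneg intro: F_sum)
  then have F2': "(\<lambda>(n, k). F k n) summable_on UNIV \<times> UNIV"
    using summable_on_swap[of "\<lambda>(k, n). F k n" UNIV UNIV] by simp
  then have sum_F: "(\<lambda>n. \<Sum>\<^sub>\<infinity>k. F k n) summable_on UNIV"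
    using summable_on_Sigma_banach[of "\<lambda>n k. F k n" UNIV "\<lambda>_. UNIV"] by simp
  have F_row: "(\<lambda>k. F k n) summable_on UNIV" for n
    using summable_on_SigmaD1[OF F2', of n] by simp
  have le: "cmod (fourier (\<lambda>\<theta>. f \<theta> * g \<theta>) n) \<le> (\<Sum>\<^sub>\<infinity>k. F k n)" for n
    unfolding fourier_wiener_mult[OF f wiener_L2[OF g]] F_def
    using norm_infsum_bound[of "\<lambda>k. fourier f k * fourier g (n - k)" UNIV] F_row[of n]
    by (simp add: norm_mult F_def)
  have L2: "(\<lambda>\<theta>. f \<theta> * g \<theta>) \<in> L2"
    by (rule wiener_mult_L2[OF f wiener_L2[OF g]])
  have sum: "(\<lambda>n. cmod (fourier (\<lambda>\<theta>. f \<theta> * g \<theta>) n)) summable_on UNIV"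
    by (rule summable_on_comparison_test[OF sum_F]) (use le in auto)
  then show "(\<lambda>\<theta>. f \<theta> * g \<theta>) \<in> wiener"
    using L2 by (simp add: wiener_def)
  have "wiener_norm (\<lambda>\<theta>. f \<theta> * g \<theta>) \<le> (\<Sum>\<^sub>\<infinity>n. \<Sum>\<^sub>\<infinity>k. F k n)"
    unfolding wiener_norm_def by (rule infsum_mono[OF sum sum_F]) (use le in auto)
  also have "\<dots> = (\<Sum>\<^sub>\<infinity>k. \<Sum>\<^sub>\<infinity>n. F k n)"
    by (rule infsum_swap_banach[OF F2'])
  also have "\<dots> = (\<Sum>\<^sub>\<infinity>k. cmod (fourier f k) * wiener_norm g)"
    by (intro infsum_cong infsumI F_sum)
  also have "\<dots> = wiener_norm f * wiener_norm g"
    unfolding wiener_norm_def[of f] by (intro infsum_cmult_left wiener_summable f)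
  finally show "wiener_norm (\<lambda>\<theta>. f \<theta> * g \<theta>) \<le> wiener_norm f * wiener_norm g" .
qed

lemma wiener_add:
  assumes f: "f \<in> wiener" and g: "g \<in> wiener"
  shows "(\<lambda>\<theta>. f \<theta> + g \<theta>) \<in> wiener"
    and "wiener_norm (\<lambda>\<theta>. f \<theta> + g \<theta>) \<le> wiener_norm f + wiener_norm g"
proof -
  have L2: "f \<in> L2" "g \<in> L2"
    using f g by (auto intro: wiener_L2)
  have le: "cmod (fourier (\<lambda>\<theta>. f \<theta> + g \<theta>) n) \<le> cmod (fourier f n) + cmod (fourier g n)" for n
    using L2 by (simp add: fourier_add L2_integrable norm_triangle_ineq)
  have sum_fg: "(\<lambda>n. cmod (fourier f n) + cmod (fourier g n)) summable_on UNIV"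
    by (intro summable_on_add wiener_summable f g)
  have sum: "(\<lambda>n. cmod (fourier (\<lambda>\<theta>. f \<theta> + g \<theta>) n)) summable_on UNIV"
    by (rule summable_on_comparison_test[OF sum_fg]) (use le in auto)
  then show "(\<lambda>\<theta>. f \<theta> + g \<theta>) \<in> wiener"
    using L2 by (simp add: wiener_def L2_add)
  have "wiener_norm (\<lambda>\<theta>. f \<theta> + g \<theta>) \<le> (\<Sum>\<^sub>\<infinity>n. cmod (fourier f n) + cmod (fourier g n))"
    unfolding wiener_norm_def by (rule infsum_mono[OF sum sum_fg]) (use le in auto)
  also have "\<dots> = wiener_norm f + wiener_norm g"
    unfolding wiener_norm_def by (intro infsum_add wiener_summable f g)
  finally show "wiener_norm (\<lambda>\<theta>. f \<theta> + g \<theta>) \<le> wiener_norm f + wiener_norm g" .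
qed

lemma wiener_scale:
  assumes f: "f \<in> wiener"
  shows "(\<lambda>\<theta>. c * f \<theta>) \<in> wiener" "wiener_norm (\<lambda>\<theta>. c * f \<theta>) = cmod c * wiener_norm f"
  using f unfolding wiener_def wiener_norm_def
  by (auto simp: fourier_scale norm_mult L2_scale summable_on_cmult_right infsum_cmult_right)

lemma wiener_diff:
  "f \<in> wiener \<Longrightarrow> g \<in> wiener \<Longrightarrow> (\<lambda>\<theta>. f \<theta> - g \<theta>) \<in> wiener"
  using wiener_add(1)[OF _ wiener_scale(1)[of g "-1"]] by simp

lemma wiener_cnj: "f \<in> wiener \<Longrightarrow> (\<lambda>\<theta>. cnj (f \<theta>)) \<in> wiener"
  by (rule wiener_dominated_reindex(1)[of f _ uminus])
     (auto simp: fourier_cnj L2_cnj wiener_L2)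

lemma wiener_abs_sq: "f \<in> wiener \<Longrightarrow> abs_sq f \<in> wiener"
  using wiener_mult(1)[OF _ wiener_cnj, of f f]
  by (simp add: abs_sq_def complex_norm_square del: of_real_power)

lemma wiener_shift: "f \<in> wiener \<Longrightarrow> shift f \<in> wiener"
  by (rule wiener_dominated_reindex(1)[of f _ "\<lambda>n. n - 1"])
     (auto simp: fourier_shift shift_L2 wiener_L2 inj_def)

lemma wiener_shift_adj: "f \<in> wiener \<Longrightarrow> shift_adj f \<in> wiener"
  by (rule wiener_dominated_reindex(1)[of f _ "\<lambda>n. n + 1"])
     (auto simp: fourier_shift_adj shift_adj_L2 wiener_L2 inj_def)

lemma wiener_szego_proj: "f \<in> wiener \<Longrightarrow> szego_proj f \<in> wiener"
  by (rule wiener_dominated_reindex(1)[of f _ id])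
     (auto simp: fourier_szego_proj szego_proj_L2 wiener_L2)

subsection \<open>Products of functions with one-sided spectrum\<close>

lemma L2_plus_L2: "h \<in> L2_plus \<Longrightarrow> h \<in> L2"
  by (simp add: L2_plus_iff)

text \<open>In each term of the convolution at a negative index \<open>n\<close>, either
  \<open>k\<close> or \<open>n - k\<close> is negative.\<close>

lemma L2_plus_mult:
  assumes f: "f \<in> wiener" "f \<in> L2_plus" and h: "h \<in> L2_plus"
  shows "(\<lambda>\<theta>. f \<theta> * h \<theta>) \<in> L2_plus"
  unfolding L2_plus_iff
proof (intro conjI allI impI)
  show "(\<lambda>\<theta>. f \<theta> * h \<theta>) \<in> L2"
    by (rule wiener_mult_L2[OF f(1) L2_plus_L2[OF h]])
  fix n :: int assume "n < 0"
  then have "fourier f k * fourier h (n - k) = 0" for k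
    using f(2) h by (cases "k < 0") (auto simp: L2_plus_iff)
  then show "fourier (\<lambda>\<theta>. f \<theta> * h \<theta>) n = 0"
    unfolding fourier_wiener_mult[OF f(1) L2_plus_L2[OF h]] by (simp only: infsum_0_simp)
qed

text \<open>The conjugate of \<open>h\<close> has no positive frequencies, so multiplying by it
  cannot raise the spectrum of \<open>f\<close>. With \<open>m = 0\<close> this discards what the
  projector removed from a symbol; with \<open>m = 1\<close> it discards the constant term of a
  symbol under \<open>K_op\<close>.\<close>

lemma fourier_mult_cnj_L2_plus_eq_0:
  assumes f: "f \<in> wiener" "\<And>k. k \<ge> m \<Longrightarrow> fourier f k = 0" and h: "h \<in> L2_plus" and "n \<ge> m"
  shows "fourier (\<lambda>\<theta>. f \<theta> * cnj (h \<theta>)) n = 0"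
proof -
  have "fourier f k * fourier (\<lambda>\<theta>. cnj (h \<theta>)) (n - k) = 0" for k
    using f(2)[of k] h \<open>n \<ge> m\<close> by (cases "k \<ge> m") (auto simp: L2_plus_iff fourier_cnj)
  then show ?thesis
    unfolding fourier_wiener_mult[OF f(1) L2_cnj[OF L2_plus_L2[OF h]]]
    by (simp only: infsum_0_simp)
qed

lemma wiener_mult_cnj_L2: "f \<in> wiener \<Longrightarrow> h \<in> L2 \<Longrightarrow> (\<lambda>\<theta>. f \<theta> * cnj (h \<theta>)) \<in> L2"
  by (intro wiener_mult_L2 L2_cnj)

text \<open>Exchanges factors inside a product when they are known only through their
  coefficients.\<close>

lemma fourier_wiener_mult_cong:
  assumes "f \<in> wiener" "g \<in> wiener" "fourier f = fourier g" "h \<in> L2" "k \<in> L2" "fourier h = fourier k"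
  shows "fourier (\<lambda>\<theta>. f \<theta> * h \<theta>) = fourier (\<lambda>\<theta>. g \<theta> * k \<theta>)"
  using assms by (simp add: fun_eq_iff fourier_wiener_mult)

subsection \<open>Hankel and Toeplitz operators\<close>

text \<open>The cases \<open>j = 0\<close> and \<open>j = 1\<close> are \<open>H\<^sub>u\<close> and \<open>K\<^sub>u\<close>, whose cubic identities have the same proof.\<close>

definition shifted_hankel :: "int \<Rightarrow> (real \<Rightarrow> complex) \<Rightarrow> operator" where
  "shifted_hankel j u h = fourier_series (\<lambda>n. if n \<ge> 0 then fourier (\<lambda>\<theta>. u \<theta> * cnj (h \<theta>)) (n + j) else 0)"

lemma hankel_eq: "hankel u h = shifted_hankel 0 u h"
  by (simp add: hankel_def szego_proj_def shifted_hankel_def cong: if_cong)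

lemma K_op_eq:
  assumes "u \<in> wiener" "h \<in> L2"
  shows "K_op u h = shifted_hankel 1 u h"
proof -
  have "(\<lambda>n. if n \<ge> 0 then fourier (hankel u h) (n + 1) else 0)
      = (\<lambda>n. if n \<ge> 0 then fourier (\<lambda>\<theta>. u \<theta> * cnj (h \<theta>)) (n + 1) else 0)"
    using assms by (auto simp: fun_eq_iff hankel_def fourier_szego_proj wiener_mult_cnj_L2)
  then show ?thesis
    unfolding K_op_def shift_adj_def shifted_hankel_def by simp
qed

lemma
  assumes "u \<in> wiener" "h \<in> L2"
  shows shifted_hankel_L2_plus: "shifted_hankel j u h \<in> L2_plus"
    and fourier_shifted_hankel: "fourier (shifted_hankel j u h) n
      = (if n \<ge> 0 then fourier (\<lambda>\<theta>. u \<theta> * cnj (h \<theta>)) (n + j) else 0)"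
proof -
  have "(\<lambda>n. (cmod (if n \<ge> 0 then fourier (\<lambda>\<theta>. u \<theta> * cnj (h \<theta>)) (n + j) else 0))\<^sup>2) summable_on UNIV"
    by (rule summable_on_dominated_reindex(1)[OF fourier_sq_summable(1)[OF wiener_mult_cnj_L2[OF assms]],
          of "\<lambda>n. n + j"]) (auto simp: inj_def)
  from fourier_series_spec[OF this]
  show "shifted_hankel j u h \<in> L2_plus" "fourier (shifted_hankel j u h) n
      = (if n \<ge> 0 then fourier (\<lambda>\<theta>. u \<theta> * cnj (h \<theta>)) (n + j) else 0)"
    unfolding shifted_hankel_def by (auto simp: L2_plus_iff)
qed

lemma shifted_hankel_L2: "u \<in> wiener \<Longrightarrow> h \<in> L2 \<Longrightarrow> shifted_hankel j u h \<in> L2"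
  by (rule L2_plus_L2[OF shifted_hankel_L2_plus])

lemma fourier_shifted_hankel_diff:
  assumes "u \<in> wiener" "f \<in> L2" "g \<in> L2"
  shows "fourier (shifted_hankel j u (\<lambda>\<theta>. f \<theta> - g \<theta>)) n
    = fourier (shifted_hankel j u f) n - fourier (shifted_hankel j u g) n"
  using assms
  by (simp add: fourier_shifted_hankel L2_diff right_diff_distrib fourier_diff L2_integrable
      wiener_mult_cnj_L2)

lemma fourier_shifted_hankel_scale:
  assumes "u \<in> wiener" "f \<in> L2"
  shows "fourier (shifted_hankel j u (\<lambda>\<theta>. c * f \<theta>)) n = cnj c * fourier (shifted_hankel j u f) n"
  using assms fourier_scale[of "cnj c" "\<lambda>\<theta>. u \<theta> * cnj (f \<theta>)"]
  by (simp add: fourier_shifted_hankel L2_scale mult_ac)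

lemma toeplitz_L2_plus: "b \<in> wiener \<Longrightarrow> h \<in> L2 \<Longrightarrow> toeplitz b h \<in> L2_plus"
  unfolding toeplitz_def by (intro szego_proj_L2_plus wiener_mult_L2)

lemma fourier_toeplitz:
  "b \<in> wiener \<Longrightarrow> h \<in> L2 \<Longrightarrow>
    fourier (toeplitz b h) n = (if n \<ge> 0 then fourier (\<lambda>\<theta>. b \<theta> * h \<theta>) n else 0)"
  unfolding toeplitz_def by (intro fourier_szego_proj wiener_mult_L2)

definition cubic :: "(real \<Rightarrow> complex) \<Rightarrow> real \<Rightarrow> complex" where
  "cubic u = szego_proj (\<lambda>\<theta>. abs_sq u \<theta> * u \<theta>)"

lemma cubic_wiener: "u \<in> wiener \<Longrightarrow> cubic u \<in> wiener"
  unfolding cubic_def by (intro wiener_szego_proj wiener_mult wiener_abs_sq)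

text \<open>
  Write \<open>X h = shifted_hankel j u h\<close>. The remainder \<open>R = u \<cdot> cnj h - S\<^sup>j (X h)\<close> has no positive
  frequencies because \<open>j \<le> 1\<close>, so \<open>u \<cdot> cnj R\<close> lies in \<open>L\<^sup>2\<^sub>+\<close> and equals \<open>T h - X (X h)\<close>.
  The identity then follows from \<open>\<bar>u\<bar>\<^sup>2 u \<cdot> cnj h = \<bar>u\<bar>\<^sup>2 S\<^sup>j (X h) + u \<cdot> cnj (u \<cdot> cnj R)\<close>.
\<close>

lemma fourier_shifted_hankel_cubic:
  assumes u: "u \<in> wiener" "u \<in> L2_plus" and h: "h \<in> L2_plus" and j: "0 \<le> j" "j \<le> 1"
  shows "fourier (shifted_hankel j (cubic u) h) n
    = fourier (toeplitz (abs_sq u) (shifted_hankel j u h)) n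
      + fourier (shifted_hankel j u (toeplitz (abs_sq u) h)) n
      - fourier (shifted_hankel j u (shifted_hankel j u (shifted_hankel j u h))) n"
proof (cases "n \<ge> 0")
  case False
  with u h show ?thesis
    by (simp add: fourier_shifted_hankel fourier_toeplitz cubic_wiener wiener_abs_sq L2_plus_L2
        shifted_hankel_L2 toeplitz_L2_plus)
next
  case True
  define X where "X = shifted_hankel j u"
  define T where "T = toeplitz (abs_sq u)"
  define E where "E \<theta> = cis (of_int j * \<theta>)" for \<theta>
  note h2 = L2_plus_L2[OF h]
  note au = wiener_abs_sq[OF u(1)]
  have X: "X f \<in> L2_plus" "X f \<in> L2" if "f \<in> L2" for f
    unfolding X_def using u(1) that by (auto intro: shifted_hankel_L2_plus shifted_hankel_L2)
  have T: "T f \<in> L2_plus" "T f \<in> L2" if "f \<in> L2" for f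
    unfolding T_def using au that by (auto intro: toeplitz_L2_plus L2_plus_L2)
  have E_L2: "(\<lambda>\<theta>. E \<theta> * f \<theta>) \<in> L2" if "f \<in> L2" for f
    unfolding E_def using that by (rule L2_mult_cis)
  have E_fourier: "fourier (\<lambda>\<theta>. E \<theta> * f \<theta>) m = fourier f (m - j)" for f m
    unfolding E_def by (rule fourier_mult_cis)
  define R where "R \<theta> = u \<theta> * cnj (h \<theta>) - E \<theta> * X h \<theta>" for \<theta>
  define g where "g \<theta> = cnj (R \<theta>)" for \<theta>
  have R_L2: "R \<in> L2"
    unfolding R_def[abs_def] by (intro L2_diff E_L2 X wiener_mult_cnj_L2 u h2)
  have R0: "fourier R m = 0" if "m > 0" for m
  proof -
    have "fourier R m = fourier (\<lambda>\<theta>. u \<theta> * cnj (h \<theta>)) m - fourier (\<lambda>\<theta>. E \<theta> * X h \<theta>) m"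
      unfolding R_def[abs_def]
      by (intro fourier_diff L2_integrable E_L2 X wiener_mult_cnj_L2 u h2)
    then show ?thesis
      using that j u h2 by (simp add: E_fourier X_def fourier_shifted_hankel)
  qed
  have g: "g \<in> L2_plus"
    unfolding L2_plus_iff g_def[abs_def] using R0 by (auto simp: fourier_cnj intro: L2_cnj R_L2)
  have ug: "(\<lambda>\<theta>. u \<theta> * g \<theta>) \<in> L2_plus"
    by (rule L2_plus_mult[OF u g])
  define p where "p \<theta> = T h \<theta> - X (X h) \<theta>" for \<theta>
  have p_L2: "p \<in> L2"
    unfolding p_def[abs_def] by (intro L2_diff X T h2)
  \<comment> \<open>Conjugating \<open>E\<close> turns the shift up by \<open>j\<close> into a shift
    down, matching the index \<open>n + j\<close> in \<open>shifted_hankel\<close>: at nonnegative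
    frequencies these are the coefficients of \<open>X (X h)\<close>.\<close>
  have uEX: "fourier (\<lambda>\<theta>. u \<theta> * cnj (E \<theta> * X h \<theta>)) m = fourier (\<lambda>\<theta>. u \<theta> * cnj (X h \<theta>)) (m + j)" for m
  proof -
    have eq: "(\<lambda>\<theta>. u \<theta> * cnj (E \<theta> * X h \<theta>)) = (\<lambda>\<theta>. cis (of_int (- j) * \<theta>) * (u \<theta> * cnj (X h \<theta>)))"
      by (simp add: fun_eq_iff E_def cis_cnj)
    show ?thesis
      unfolding eq fourier_mult_cis by simp
  qed
  have p_eq: "fourier p = fourier (\<lambda>\<theta>. u \<theta> * g \<theta>)"
  proof
    fix m
    have "fourier p m = fourier (T h) m - fourier (X (X h)) m"
      unfolding p_def[abs_def] by (intro fourier_diff L2_integrable X T h2)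
    moreover have "fourier (\<lambda>\<theta>. u \<theta> * g \<theta>) m
        = fourier (\<lambda>\<theta>. abs_sq u \<theta> * h \<theta>) m - fourier (\<lambda>\<theta>. u \<theta> * cnj (X h \<theta>)) (m + j)"
    proof -
      have "(\<lambda>\<theta>. u \<theta> * g \<theta>) = (\<lambda>\<theta>. abs_sq u \<theta> * h \<theta> - u \<theta> * cnj (E \<theta> * X h \<theta>))"
        by (auto simp: fun_eq_iff g_def R_def abs_sq_def complex_norm_square algebra_simps
            simp del: of_real_power)
      then show ?thesis
        unfolding uEX[symmetric] by (simp only:) (intro fourier_diff L2_integrable wiener_mult_cnj_L2 wiener_mult_L2 E_L2 X u au h2)
    qed
    moreover have "fourier (\<lambda>\<theta>. u \<theta> * g \<theta>) m = 0" if "m < 0"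
      using ug that by (simp add: L2_plus_iff)
    ultimately show "fourier p m = fourier (\<lambda>\<theta>. u \<theta> * g \<theta>) m"
      using u(1) au h2 X(2)
      by (cases "m \<ge> 0") (auto simp: X_def T_def fourier_toeplitz fourier_shifted_hankel)
  qed
  define f where "f \<theta> = abs_sq u \<theta> * u \<theta>" for \<theta>
  have f: "f \<in> wiener"
    unfolding f_def[abs_def] by (intro wiener_mult au u)
  have cubic_f: "cubic u = szego_proj f"
    by (simp add: cubic_def f_def[abs_def])
  have "fourier (shifted_hankel j (cubic u) h) n = fourier (\<lambda>\<theta>. cubic u \<theta> * cnj (h \<theta>)) (n + j)"
    using True u h2 by (simp add: fourier_shifted_hankel cubic_wiener)
  \<comment> \<open>Projecting \<open>f\<close> removed only negative frequencies, which the
    conjugate of \<open>h\<close> cannot raise to the index \<open>n + j \<ge> 0\<close>.\<close>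
  also have "\<dots> = fourier (\<lambda>\<theta>. f \<theta> * cnj (h \<theta>)) (n + j)"
  proof -
    have "fourier (\<lambda>\<theta>. (f \<theta> - cubic u \<theta>) * cnj (h \<theta>)) (n + j) = 0"
      using f u True j
      by (intro fourier_mult_cnj_L2_plus_eq_0[where m=0] wiener_diff cubic_wiener h)
         (auto simp: fourier_diff L2_integrable wiener_L2 cubic_wiener cubic_f fourier_szego_proj
            szego_proj_L2)
    moreover have "fourier (\<lambda>\<theta>. (f \<theta> - cubic u \<theta>) * cnj (h \<theta>)) (n + j)
        = fourier (\<lambda>\<theta>. f \<theta> * cnj (h \<theta>)) (n + j) - fourier (\<lambda>\<theta>. cubic u \<theta> * cnj (h \<theta>)) (n + j)"
      unfolding left_diff_distrib
      by (intro fourier_diff L2_integrable wiener_mult_cnj_L2 f cubic_wiener u h2)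
    ultimately show ?thesis by simp
  qed
  also have "\<dots> = fourier (\<lambda>\<theta>. E \<theta> * (abs_sq u \<theta> * X h \<theta>) + u \<theta> * cnj (u \<theta> * g \<theta>)) (n + j)"
    by (intro arg_cong2[where f=fourier] ext)
       (auto simp: f_def g_def R_def abs_sq_def complex_norm_square algebra_simps simp del: of_real_power)
  also have "\<dots> = fourier (\<lambda>\<theta>. E \<theta> * (abs_sq u \<theta> * X h \<theta>)) (n + j)
      + fourier (\<lambda>\<theta>. u \<theta> * cnj (u \<theta> * g \<theta>)) (n + j)"
    by (intro fourier_add L2_integrable E_L2 wiener_mult_cnj_L2 wiener_mult_L2 au u X h2
        L2_plus_L2[OF ug])
  also have "fourier (\<lambda>\<theta>. E \<theta> * (abs_sq u \<theta> * X h \<theta>)) (n + j) = fourier (T (X h)) n"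
    using True au X(2)[OF h2] by (simp add: E_fourier T_def fourier_toeplitz)
  also have "fourier (\<lambda>\<theta>. u \<theta> * cnj (u \<theta> * g \<theta>)) (n + j) = fourier (\<lambda>\<theta>. u \<theta> * cnj (p \<theta>)) (n + j)"
    using p_eq
    by (intro fun_cong[OF fourier_wiener_mult_cong] u L2_cnj p_L2 L2_plus_L2[OF ug])
       (auto simp: fun_eq_iff fourier_cnj simp del: complex_cnj_mult)
  also have "\<dots> = fourier (X p) n"
    using True u p_L2 by (simp add: X_def fourier_shifted_hankel)
  also have "\<dots> = fourier (X (T h)) n - fourier (X (X (X h))) n"
    unfolding p_def[abs_def] using u(1) X(2) T(2) h2
    by (simp add: X_def fourier_shifted_hankel_diff)
  finally show ?thesis
    unfolding X_def T_def by simp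
qed

text \<open>Up to a null set, \<open>u - shift (shift_adj u)\<close> is the constant term of
  \<open>u\<close>. Its product with the conjugate of \<open>h\<close> has no positive frequencies,
  while only indices \<open>n + 1\<close> with \<open>n \<ge> 0\<close> are read. Both sides apply
  \<open>fourier_series\<close> to the same sequence, so they agree as functions and may be
  exchanged inside further operators.\<close>

lemma shifted_hankel_1_eq_hankel:
  assumes u: "u \<in> wiener" "u \<in> L2_plus" and h: "h \<in> L2_plus"
  shows "shifted_hankel 1 u h = shifted_hankel 0 (shift_adj u) h"
proof -
  define w where "w = shift_adj u"
  have w: "w \<in> wiener"
    unfolding w_def by (rule wiener_shift_adj[OF u(1)])
  note h2 = L2_plus_L2[OF h]
  have "fourier (\<lambda>\<theta>. u \<theta> * cnj (h \<theta>)) (n + 1) = fourier (\<lambda>\<theta>. w \<theta> * cnj (h \<theta>)) n" if "n \<ge> 0" for n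
  proof -
    have "fourier (\<lambda>\<theta>. (u \<theta> - shift w \<theta>) * cnj (h \<theta>)) (n + 1) = 0"
      using u w that
      by (intro fourier_mult_cnj_L2_plus_eq_0[where m=1] wiener_diff wiener_shift h)
         (auto simp: fourier_diff L2_integrable wiener_L2 shift_L2 fourier_shift w_def fourier_shift_adj
          shift_adj_L2)
    moreover have "fourier (\<lambda>\<theta>. (u \<theta> - shift w \<theta>) * cnj (h \<theta>)) (n + 1)
        = fourier (\<lambda>\<theta>. u \<theta> * cnj (h \<theta>)) (n + 1) - fourier (\<lambda>\<theta>. shift w \<theta> * cnj (h \<theta>)) (n + 1)"
      unfolding left_diff_distrib
      by (intro fourier_diff L2_integrable wiener_mult_cnj_L2 wiener_shift w u h2)
    moreover have "fourier (\<lambda>\<theta>. shift w \<theta> * cnj (h \<theta>)) (n + 1) = fourier (\<lambda>\<theta>. w \<theta> * cnj (h \<theta>)) n"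
      using fourier_shift[of "\<lambda>\<theta>. w \<theta> * cnj (h \<theta>)" "n + 1"] by (simp add: shift_def mult.assoc)
    ultimately show ?thesis by simp
  qed
  then have "(\<lambda>n. if n \<ge> 0 then fourier (\<lambda>\<theta>. u \<theta> * cnj (h \<theta>)) (n + 1) else 0)
      = (\<lambda>n. if n \<ge> 0 then fourier (\<lambda>\<theta>. w \<theta> * cnj (h \<theta>)) (n + 0) else 0)"
    by auto
  then show ?thesis
    unfolding shifted_hankel_def w_def by simp
qed

subsection \<open>The Lax commutator\<close>

text \<open>The value that the equation forces on the time derivative, as a function of
  \<open>u\<close> alone; its continuity in time can thus be derived from that of the curve.\<close>

definition velocity :: "real \<Rightarrow> (real \<Rightarrow> complex) \<Rightarrow> real \<Rightarrow> complex" where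
  "velocity \<beta> u = (\<lambda>\<theta>. - \<i> * (cubic u \<theta> - complex_of_real \<beta> * shift (cubic (shift_adj u)) \<theta>))"

lemma velocity_wiener: "u \<in> wiener \<Longrightarrow> velocity \<beta> u \<in> wiener"
  unfolding velocity_def
  by (intro wiener_scale(1) wiener_diff wiener_shift cubic_wiener wiener_shift_adj)

text \<open>Write \<open>X\<close> for \<open>K_op u\<close>. By antilinearity, \<i> becomes
  \<open>- \<i>\<close> when it passes through \<open>X\<close>. So the commutator of
  \<open>\<i>/2 X X\<close> with \<open>X\<close> is \<open>\<i> X X X\<close>, that of
  \<open>- \<i> T\<close> is \<open>- \<i> (T X + X T)\<close>, and together they are
  \<open>- \<i>\<close> times the cubic expression. The \<beta>-term is treated alike with
  \<open>w\<close> in place of \<open>u\<close>, since \<open>X\<close> and \<open>Y\<close> agree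
  on \<open>L2_plus\<close>. Linearity in the symbol gathers both parts into
  \<open>velocity\<close>.\<close>

lemma lax_commutator:
  fixes \<beta> :: real and u h :: "real \<Rightarrow> complex"
  assumes u: "u \<in> wiener" "u \<in> L2_plus" and h: "h \<in> L2_plus"
  defines "D \<equiv> commutator (\<lambda>h \<theta>. C_op u h \<theta> - complex_of_real \<beta> * B_op (shift_adj u) h \<theta>) (K_op u) h"
  shows "D \<in> L2" "fourier D n = fourier (K_op (velocity \<beta> u) h) n"
proof -
  define w where "w = shift_adj u"
  have w: "w \<in> wiener" "w \<in> L2_plus"
    unfolding w_def using u by (auto intro: wiener_shift_adj shift_adj_L2_plus L2_plus_L2)
  define X where "X = shifted_hankel 1 u"
  define Y where "Y = shifted_hankel 0 w"
  define Tu where "Tu = toeplitz (abs_sq u)"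
  define Tw where "Tw = toeplitz (abs_sq w)"
  note h2 = L2_plus_L2[OF h]
  have XY: "X f = Y f" if "f \<in> L2_plus" for f
    unfolding X_def Y_def w_def by (rule shifted_hankel_1_eq_hankel[OF u that])
  have plus: "Y f \<in> L2_plus" "Tu f \<in> L2_plus" "Tw f \<in> L2_plus" "X f \<in> L2_plus" if "f \<in> L2" for f
    unfolding X_def Y_def Tu_def Tw_def using u w that
    by (auto intro: shifted_hankel_L2_plus toeplitz_L2_plus wiener_abs_sq)
  have L2: "Y f \<in> L2" "Tu f \<in> L2" "Tw f \<in> L2" "X f \<in> L2" if "f \<in> L2" for f
    using plus[OF that] by (auto intro: L2_plus_L2)
  have K: "K_op u f = X f" if "f \<in> L2" for f
    unfolding X_def by (rule K_op_eq[OF u(1) that])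
  have C: "C_op u f = (\<lambda>\<theta>. \<i> / 2 * X (X f) \<theta> - \<i> * Tu f \<theta>)" if "f \<in> L2" for f
    unfolding C_op_def Tu_def using that L2(4)[OF that] by (simp add: K)
  have B: "B_op w f = (\<lambda>\<theta>. \<i> / 2 * Y (Y f) \<theta> - \<i> * Tw f \<theta>)" for f
    unfolding B_op_def Tw_def Y_def by (simp add: hankel_eq)
  define G where "G f \<theta> = C_op u f \<theta> - complex_of_real \<beta> * B_op w f \<theta>" for f \<theta>
  have G_eq: "G f = (\<lambda>\<theta>. (\<i> / 2 * X (X f) \<theta> - \<i> * Tu f \<theta>)
      - complex_of_real \<beta> * (\<i> / 2 * Y (Y f) \<theta> - \<i> * Tw f \<theta>))" if "f \<in> L2" for f
    unfolding G_def[abs_def] C[OF that] B ..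
  have G_L2: "G f \<in> L2" if "f \<in> L2" for f
    unfolding G_eq[OF that] by (intro L2_diff L2_scale L2 that)
  have G_fourier: "fourier (G f) n = (\<i> / 2 * fourier (X (X f)) n - \<i> * fourier (Tu f) n)
      - complex_of_real \<beta> * (\<i> / 2 * fourier (Y (Y f)) n - \<i> * fourier (Tw f) n)" if "f \<in> L2" for f
    unfolding G_eq[OF that]
    by (subst fourier_diff fourier_scale; (intro L2_integrable L2_diff L2_scale L2 that)?)+ (rule refl)
  \<comment> \<open>The signs are opposite to those in \<open>G_fourier\<close> because scalars
    leave \<open>X\<close> conjugated; \<beta> is real and stays.\<close>
  have XG_fourier: "fourier (X (G f)) n
      = (- \<i> / 2 * fourier (X (X (X f))) n + \<i> * fourier (X (Tu f)) n)
      - complex_of_real \<beta> * (- \<i> / 2 * fourier (X (Y (Y f))) n + \<i> * fourier (X (Tw f)) n)"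
    if "f \<in> L2" for f
    unfolding G_eq[OF that] X_def
    by (subst fourier_shifted_hankel_diff fourier_shifted_hankel_scale;
        (intro u L2_diff L2_scale L2[unfolded X_def] that)?)+ simp
  have D: "D = (\<lambda>\<theta>. G (X h) \<theta> - X (G h) \<theta>)"
    unfolding D_def commutator_def w_def[symmetric] G_def[abs_def, symmetric]
    using h2 K[OF G_L2[OF h2]] by (simp add: K)
  show "D \<in> L2"
    unfolding D by (intro L2_diff G_L2 L2 h2)
  have "fourier D n = fourier (G (X h)) n - fourier (X (G h)) n"
    unfolding D by (intro fourier_diff L2_integrable G_L2 L2 h2)
  also have "\<dots> = - \<i> * (fourier (Tu (X h)) n + fourier (X (Tu h)) n - fourier (X (X (X h))) n)
      + \<i> * complex_of_real \<beta> * (fourier (Tw (Y h)) n + fourier (Y (Tw h)) n - fourier (Y (Y (Y h))) n)"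
    unfolding G_fourier[OF L2(4)[OF h2]] XG_fourier[OF h2]
    by (simp add: XY h plus L2 h2 algebra_simps)
  also have "\<dots> = - \<i> * fourier (shifted_hankel 1 (cubic u) h) n
      + \<i> * complex_of_real \<beta> * fourier (shifted_hankel 0 (cubic w) h) n"
    using fourier_shifted_hankel_cubic[OF u h, of 1 n] fourier_shifted_hankel_cubic[OF w h, of 0 n]
    by (simp add: X_def Y_def Tu_def Tw_def)
  also have "\<dots> = fourier (shifted_hankel 1 (velocity \<beta> u) h) n"
  proof (cases "n \<ge> 0")
    case True
    \<comment> \<open>The index \<open>n + 1\<close> read by \<open>K_op\<close> undoes the outer
      shift in the \<beta>-term of the equation.\<close>
    have sh: "fourier (\<lambda>\<theta>. shift (cubic w) \<theta> * cnj (h \<theta>)) (n + 1) = fourier (\<lambda>\<theta>. cubic w \<theta> * cnj (h \<theta>)) n"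
      using fourier_shift[of "\<lambda>\<theta>. cubic w \<theta> * cnj (h \<theta>)" "n + 1"] by (simp add: shift_def mult.assoc)
    have "fourier (\<lambda>\<theta>. velocity \<beta> u \<theta> * cnj (h \<theta>)) (n + 1)
        = fourier (\<lambda>\<theta>. - \<i> * (cubic u \<theta> * cnj (h \<theta>))
            - - \<i> * complex_of_real \<beta> * (shift (cubic w) \<theta> * cnj (h \<theta>))) (n + 1)"
      by (simp add: velocity_def w_def algebra_simps)
    also have "\<dots> = - \<i> * fourier (\<lambda>\<theta>. cubic u \<theta> * cnj (h \<theta>)) (n + 1)
        + \<i> * complex_of_real \<beta> * fourier (\<lambda>\<theta>. cubic w \<theta> * cnj (h \<theta>)) n"
      by (subst fourier_diff; (intro L2_integrable L2_scale wiener_mult_cnj_L2 wiener_shift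
            cubic_wiener u w h2)?) (simp only: fourier_scale sh, simp)
    finally show ?thesis
      using True u w h2 by (simp add: fourier_shifted_hankel cubic_wiener velocity_wiener)
  qed (use u w h2 in \<open>simp add: fourier_shifted_hankel cubic_wiener velocity_wiener\<close>)
  also have "\<dots> = fourier (K_op (velocity \<beta> u) h) n"
    by (simp add: K_op_eq velocity_wiener u h2)
  finally show "fourier D n = fourier (K_op (velocity \<beta> u) h) n" .
qed

subsection \<open>Sobolev functions of order above one half\<close>

text \<open>For \<open>n > 0\<close> the term is at most \<open>n powr (- 2 * s)\<close>, and the
  negative integers follow by symmetry.\<close>

lemma summable_bracket_powr:
  fixes s :: real
  assumes "s > 1/2"
  shows "(\<lambda>n::int. (1 + (of_int n)\<^sup>2) powr (- s)) summable_on UNIV"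
proof -
  define q where "q n = (1 + (of_int n)\<^sup>2) powr (- s)" for n :: int
  have "summable (\<lambda>n. q (int n))"
  proof (rule summable_comparison_test_ev)
    show "summable (\<lambda>n. real n powr (- 2 * s))"
      using assms by (simp add: summable_real_powr_iff)
    show "\<forall>\<^sub>F n in sequentially. norm (q (int n)) \<le> real n powr (- 2 * s)"
      using eventually_gt_at_top[of 0]
    proof eventually_elim
      case (elim n)
      have "(1 + (real n)\<^sup>2) powr (- s) \<le> ((real n)\<^sup>2) powr (- s)"
        by (rule powr_mono2') (use assms elim in auto)
      also have "((real n)\<^sup>2) powr (- s) = real n powr (- 2 * s)"
        using elim by (simp add: powr_powr flip: powr_numeral)
      finally show ?case
        by (simp add: q_def)
    qed
  qed
  then have nat: "(\<lambda>n. q (int n)) summable_on UNIV"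
    by (subst summable_on_UNIV_nonneg_real_iff) (simp_all add: q_def)
  have "q summable_on range int"
    using summable_on_reindex[of int UNIV q] nat by (simp add: o_def)
  moreover have "q summable_on range (\<lambda>n. - int n)"
    using summable_on_reindex[of "\<lambda>n. - int n" UNIV q] nat by (simp add: o_def inj_def q_def)
  moreover have "UNIV = range int \<union> range (\<lambda>n. - int n)"
    using int_cases2 by blast
  ultimately show ?thesis
    unfolding q_def[abs_def, symmetric] by (metis summable_on_union)
qed

text \<open>Cauchy-Schwarz: the modulus of a coefficient is \<open>sqrt (q n)\<close> times the
  square root \<open>sqrt (p n)\<close> of its weighted square. The constant is the square root of
  the sum of \<open>q\<close>, finite because \<open>s > 1/2\<close>.\<close>

lemma wiener_sobolev:
  assumes "s > 1/2"
  obtains C where "\<And>f. f \<in> sobolev s \<Longrightarrow> f \<in> wiener"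
    "\<And>f. f \<in> sobolev s \<Longrightarrow> wiener_norm f \<le> C * sobolev_norm s f"
proof -
  define q where "q n = (1 + (of_int n)\<^sup>2) powr (- s)" for n :: int
  have q: "q summable_on UNIV"
    unfolding q_def[abs_def] by (rule summable_bracket_powr[OF assms])
  define C where "C = sqrt (infsum q UNIV)"
  have bound: "(\<Sum>n\<in>F. cmod (fourier f n)) \<le> C * sobolev_norm s f"
    if f: "f \<in> sobolev s" and F: "finite F" for f F
  proof -
    define p where "p n = (1 + (of_int n)\<^sup>2) powr s * (cmod (fourier f n))\<^sup>2" for n :: int
    have p: "p summable_on UNIV"
      using f unfolding sobolev_def p_def by simp
    have pos: "0 < 1 + (real_of_int n)\<^sup>2" for n :: int
      by (simp add: add_pos_nonneg)
    have "q n * p n = (cmod (fourier f n))\<^sup>2" for n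
      using pos[of n] by (simp add: q_def p_def powr_minus)
    then have "cmod (fourier f n) = \<bar>sqrt (q n)\<bar> * \<bar>sqrt (p n)\<bar>" for n
      by (metis abs_mult abs_of_nonneg norm_ge_zero real_sqrt_abs real_sqrt_mult)
    then have "(\<Sum>n\<in>F. cmod (fourier f n)) = (\<Sum>n\<in>F. \<bar>sqrt (q n)\<bar> * \<bar>sqrt (p n)\<bar>)"
      by simp
    also have "\<dots> \<le> L2_set (\<lambda>n. sqrt (q n)) F * L2_set (\<lambda>n. sqrt (p n)) F"
      by (rule L2_set_mult_ineq)
    also have "\<dots> = sqrt (sum q F) * sqrt (sum p F)"
      by (simp add: L2_set_def q_def p_def)
    also have "\<dots> \<le> C * sqrt (infsum p UNIV)"
      unfolding C_def using F p q
      by (intro mult_mono real_sqrt_le_mono finite_sum_le_infsum)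
         (auto simp: q_def p_def intro!: sum_nonneg infsum_nonneg)
    finally show ?thesis
      by (simp add: sobolev_norm_def p_def[abs_def])
  qed
  have sum: "(\<lambda>n. cmod (fourier f n)) summable_on UNIV" if "f \<in> sobolev s" for f
    by (rule nonneg_bdd_above_summable_on) (auto intro!: bdd_aboveI2 bound[OF that])
  show thesis
  proof (rule that)
    show "f \<in> wiener" if "f \<in> sobolev s" for f
      using sum[OF that] that by (simp add: wiener_def sobolev_def)
    show "wiener_norm f \<le> C * sobolev_norm s f" if "f \<in> sobolev s" for f
      unfolding wiener_norm_def by (rule infsum_le_finite_sums[OF sum[OF that]]) (rule bound[OF that])
  qed
qed

text \<open>An \<open>infsum\<close> over a family that is not summable is 0, so
  \<open>sobolev_norm\<close> is informative only on members of \<open>sobolev s\<close>. Continuity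
  of the curve speaks of differences, hence this closure property.\<close>

lemma sobolev_diff:
  assumes f: "f \<in> sobolev s" and g: "g \<in> sobolev s"
  shows "(\<lambda>\<theta>. f \<theta> - g \<theta>) \<in> sobolev s"
proof -
  define b where "b n = (1 + (of_int n)\<^sup>2) powr s" for n :: int
  have L2: "f \<in> L2" "g \<in> L2"
    using f g by (auto simp: sobolev_def)
  have sum: "(\<lambda>n. 2 * (b n * (cmod (fourier f n))\<^sup>2) + 2 * (b n * (cmod (fourier g n))\<^sup>2)) summable_on UNIV"
    using f g by (intro summable_on_add summable_on_cmult_right) (auto simp: sobolev_def b_def)
  have le: "b n * (cmod (fourier (\<lambda>\<theta>. f \<theta> - g \<theta>) n))\<^sup>2
      \<le> 2 * (b n * (cmod (fourier f n))\<^sup>2) + 2 * (b n * (cmod (fourier g n))\<^sup>2)" for n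
  proof -
    have "(cmod (fourier (\<lambda>\<theta>. f \<theta> - g \<theta>) n))\<^sup>2 \<le> (cmod (fourier f n) + cmod (fourier g n))\<^sup>2"
      using L2 by (intro power_mono) (simp_all add: fourier_diff L2_integrable norm_triangle_ineq4)
    also have "\<dots> \<le> 2 * (cmod (fourier f n))\<^sup>2 + 2 * (cmod (fourier g n))\<^sup>2"
      using sum_squares_bound[of "cmod (fourier f n)" "cmod (fourier g n)"]
      unfolding power2_sum by linarith
    finally have "b n * (cmod (fourier (\<lambda>\<theta>. f \<theta> - g \<theta>) n))\<^sup>2
        \<le> b n * (2 * (cmod (fourier f n))\<^sup>2 + 2 * (cmod (fourier g n))\<^sup>2)"
      by (rule mult_left_mono) (simp add: b_def)
    then show ?thesis
      by (simp add: distrib_left mult_ac)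
  qed
  have "(\<lambda>n. b n * (cmod (fourier (\<lambda>\<theta>. f \<theta> - g \<theta>) n))\<^sup>2) summable_on UNIV"
    by (rule summable_on_comparison_test[OF sum le]) (simp add: b_def)
  then show ?thesis
    using L2 by (simp add: sobolev_def L2_diff b_def)
qed

subsection \<open>Curves in the Wiener algebra\<close>

definition wiener_continuous :: "(real \<Rightarrow> real \<Rightarrow> complex) \<Rightarrow> bool" where
  "wiener_continuous u \<longleftrightarrow> (\<forall>t. u t \<in> wiener) \<and>
    (\<forall>t. ((\<lambda>r. wiener_norm (\<lambda>\<theta>. u r \<theta> - u t \<theta>)) \<longlongrightarrow> 0) (at t))"

lemma wiener_continuous_wiener: "wiener_continuous u \<Longrightarrow> u t \<in> wiener"
  by (simp add: wiener_continuous_def)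

lemma wiener_continuous_dominated:
  assumes u: "wiener_continuous u" and v: "\<And>t. v t \<in> wiener"
    and le: "\<And>r t. wiener_norm (\<lambda>\<theta>. v r \<theta> - v t \<theta>) \<le> C * wiener_norm (\<lambda>\<theta>. u r \<theta> - u t \<theta>)"
  shows "wiener_continuous v"
  unfolding wiener_continuous_def
proof (intro conjI allI v)
  fix t
  have "((\<lambda>r. C * wiener_norm (\<lambda>\<theta>. u r \<theta> - u t \<theta>))
      \<longlongrightarrow> C * 0) (at t)"
    using u by (intro tendsto_mult tendsto_const) (simp add: wiener_continuous_def)
  then have "((\<lambda>r. C * wiener_norm (\<lambda>\<theta>. u r \<theta> - u t \<theta>)) \<longlongrightarrow> 0) (at t)"
    by simp
  then show "((\<lambda>r. wiener_norm (\<lambda>\<theta>. v r \<theta> - v t \<theta>)) \<longlongrightarrow> 0) (at t)"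
    by (rule Lim_null_comparison[rotated]) (simp add: le)
qed

lemma wiener_continuous_reindex:
  assumes u: "wiener_continuous u" and v: "\<And>t. v t \<in> wiener" and "inj \<phi>"
    and le: "\<And>r t n. cmod (fourier (v r) n - fourier (v t) n)
        \<le> cmod (fourier (u r) (\<phi> n) - fourier (u t) (\<phi> n))"
  shows "wiener_continuous v"
proof (rule wiener_continuous_dominated[OF u v, where C=1])
  fix r t
  have "wiener_norm (\<lambda>\<theta>. v r \<theta> - v t \<theta>) \<le> wiener_norm (\<lambda>\<theta>. u r \<theta> - u t \<theta>)"
    using u v le
    by (intro wiener_dominated_reindex(2)[OF _ _ \<open>inj \<phi>\<close>] wiener_diff L2_diff)
       (auto intro: wiener_L2 wiener_continuous_wiener simp: fourier_diff L2_integrable wiener_L2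
         wiener_continuous_wiener)
  then show "wiener_norm (\<lambda>\<theta>. v r \<theta> - v t \<theta>) \<le> 1 * wiener_norm (\<lambda>\<theta>. u r \<theta> - u t \<theta>)"
    by simp
qed

lemma wiener_continuous_cnj: "wiener_continuous u \<Longrightarrow> wiener_continuous (\<lambda>t \<theta>. cnj (u t \<theta>))"
  by (rule wiener_continuous_reindex[of u _ uminus])
     (auto intro: wiener_cnj wiener_continuous_wiener simp: fourier_cnj simp flip: complex_cnj_diff)

lemma wiener_continuous_shift: "wiener_continuous u \<Longrightarrow> wiener_continuous (\<lambda>t. shift (u t))"
  by (rule wiener_continuous_reindex[of u _ "\<lambda>n. n - 1"])
     (auto intro: wiener_shift wiener_continuous_wiener simp: fourier_shift inj_def)

lemma wiener_continuous_shift_adj: "wiener_continuous u \<Longrightarrow> wiener_continuous (\<lambda>t. shift_adj (u t))"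
  by (rule wiener_continuous_reindex[of u _ "\<lambda>n. n + 1"])
     (auto intro: wiener_shift_adj wiener_continuous_wiener
       simp: fourier_shift_adj wiener_L2 wiener_continuous_wiener inj_def)

lemma wiener_continuous_szego_proj: "wiener_continuous u \<Longrightarrow> wiener_continuous (\<lambda>t. szego_proj (u t))"
  by (rule wiener_continuous_reindex[of u _ id])
     (auto intro: wiener_szego_proj wiener_continuous_wiener
       simp: fourier_szego_proj wiener_L2 wiener_continuous_wiener)

lemma wiener_continuous_scale: "wiener_continuous u \<Longrightarrow> wiener_continuous (\<lambda>t \<theta>. c * u t \<theta>)"
proof (rule wiener_continuous_dominated[of u _ "cmod c"])
  fix r t assume "wiener_continuous u"
  then have "(\<lambda>\<theta>. u r \<theta> - u t \<theta>) \<in> wiener"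
    by (intro wiener_diff wiener_continuous_wiener)
  from wiener_scale(2)[OF this, of c]
  show "wiener_norm (\<lambda>\<theta>. c * u r \<theta> - c * u t \<theta>) \<le> cmod c * wiener_norm (\<lambda>\<theta>. u r \<theta> - u t \<theta>)"
    by (simp add: right_diff_distrib)
qed (auto intro: wiener_scale wiener_continuous_wiener)

lemma wiener_continuous_add:
  assumes "wiener_continuous u" "wiener_continuous v"
  shows "wiener_continuous (\<lambda>t \<theta>. u t \<theta> + v t \<theta>)"
  unfolding wiener_continuous_def
proof (intro conjI allI)
  note [intro] = wiener_continuous_wiener[OF assms(1)] wiener_continuous_wiener[OF assms(2)]
  show "(\<lambda>\<theta>. u t \<theta> + v t \<theta>) \<in> wiener" for t
    by (intro wiener_add) auto
  fix t
  have le: "wiener_norm (\<lambda>\<theta>. u r \<theta> + v r \<theta> - (u t \<theta> + v t \<theta>))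
      \<le> wiener_norm (\<lambda>\<theta>. u r \<theta> - u t \<theta>) + wiener_norm (\<lambda>\<theta>. v r \<theta> - v t \<theta>)" for r
    using wiener_add(2)[OF wiener_diff wiener_diff, of "u r" "u t" "v r" "v t"]
    by (auto simp: algebra_simps)
  have "((\<lambda>r. wiener_norm (\<lambda>\<theta>. u r \<theta> - u t \<theta>) + wiener_norm (\<lambda>\<theta>. v r \<theta> - v t \<theta>))
      \<longlongrightarrow> 0 + 0) (at t)"
    using assms by (intro tendsto_add) (simp_all add: wiener_continuous_def)
  then have "((\<lambda>r. wiener_norm (\<lambda>\<theta>. u r \<theta> - u t \<theta>) + wiener_norm (\<lambda>\<theta>. v r \<theta> - v t \<theta>)) \<longlongrightarrow> 0) (at t)"
    by simp
  then show "((\<lambda>r. wiener_norm (\<lambda>\<theta>. u r \<theta> + v r \<theta> - (u t \<theta> + v t \<theta>))) \<longlongrightarrow> 0) (at t)"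
    by (rule Lim_null_comparison[rotated]) (simp add: le)
qed

lemma wiener_continuous_diff:
  "wiener_continuous u \<Longrightarrow> wiener_continuous v \<Longrightarrow> wiener_continuous (\<lambda>t \<theta>. u t \<theta> - v t \<theta>)"
  using wiener_continuous_add[OF _ wiener_continuous_scale[of v "-1"]] by simp

lemma wiener_continuous_mult:
  assumes u: "wiener_continuous u" and v: "wiener_continuous v"
  shows "wiener_continuous (\<lambda>t \<theta>. u t \<theta> * v t \<theta>)"
  unfolding wiener_continuous_def
proof (intro conjI allI)
  note uw = wiener_continuous_wiener[OF u] and vw = wiener_continuous_wiener[OF v]
  show "(\<lambda>\<theta>. u t \<theta> * v t \<theta>) \<in> wiener" for t
    by (intro wiener_mult uw vw)
  fix t
  define a where "a r = wiener_norm (\<lambda>\<theta>. u r \<theta> - u t \<theta>)" for r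
  define b where "b r = wiener_norm (\<lambda>\<theta>. v r \<theta> - v t \<theta>)" for r
  have le: "wiener_norm (\<lambda>\<theta>. u r \<theta> * v r \<theta> - u t \<theta> * v t \<theta>)
      \<le> a r * b r + a r * wiener_norm (v t) + wiener_norm (u t) * b r" for r
  proof -
    define x where "x \<theta> = u r \<theta> - u t \<theta>" for \<theta>
    define y where "y \<theta> = v r \<theta> - v t \<theta>" for \<theta>
    have x: "x \<in> wiener" and y: "y \<in> wiener"
      unfolding x_def[abs_def] y_def[abs_def] by (intro wiener_diff uw vw)+
    \<comment> \<open>Expanding around time \<open>t\<close> leaves, besides the small differences,
      only norms at \<open>t\<close>, which are constants.\<close>
    have "(\<lambda>\<theta>. u r \<theta> * v r \<theta> - u t \<theta> * v t \<theta>) = (\<lambda>\<theta>. (x \<theta> * y \<theta> + x \<theta> * v t \<theta>) + u t \<theta> * y \<theta>)"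
      by (simp add: x_def y_def fun_eq_iff algebra_simps)
    then have "wiener_norm (\<lambda>\<theta>. u r \<theta> * v r \<theta> - u t \<theta> * v t \<theta>)
        = wiener_norm (\<lambda>\<theta>. (x \<theta> * y \<theta> + x \<theta> * v t \<theta>) + u t \<theta> * y \<theta>)"
      by simp
    also have "\<dots> \<le> wiener_norm (\<lambda>\<theta>. x \<theta> * y \<theta> + x \<theta> * v t \<theta>) + wiener_norm (\<lambda>\<theta>. u t \<theta> * y \<theta>)"
      by (intro wiener_add wiener_mult x y uw vw)
    also have "\<dots> \<le> (wiener_norm (\<lambda>\<theta>. x \<theta> * y \<theta>) + wiener_norm (\<lambda>\<theta>. x \<theta> * v t \<theta>))
        + wiener_norm (\<lambda>\<theta>. u t \<theta> * y \<theta>)"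
      by (intro add_right_mono wiener_add(2) wiener_mult(1) x y vw)
    also have "\<dots> \<le> a r * b r + a r * wiener_norm (v t) + wiener_norm (u t) * b r"
      unfolding a_def b_def x_def[abs_def, symmetric] y_def[abs_def, symmetric]
      by (intro add_mono wiener_mult(2) x y uw vw)
    finally show ?thesis .
  qed
  have "((\<lambda>r. a r * b r + a r * wiener_norm (v t) + wiener_norm (u t) * b r)
      \<longlongrightarrow> 0 * 0 + 0 * wiener_norm (v t) + wiener_norm (u t) * 0) (at t)"
    unfolding a_def b_def using u v
    by (intro tendsto_add tendsto_mult tendsto_const) (simp_all add: wiener_continuous_def)
  then have "((\<lambda>r. a r * b r + a r * wiener_norm (v t) + wiener_norm (u t) * b r) \<longlongrightarrow> 0) (at t)"
    by simp
  then show "((\<lambda>r. wiener_norm (\<lambda>\<theta>. u r \<theta> * v r \<theta> - u t \<theta> * v t \<theta>)) \<longlongrightarrow> 0) (at t)"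
    by (rule Lim_null_comparison[rotated]) (simp add: le)
qed

lemma wiener_continuous_cubic:
  assumes "wiener_continuous u"
  shows "wiener_continuous (\<lambda>t. cubic (u t))"
proof -
  have "wiener_continuous (\<lambda>t \<theta>. u t \<theta> * cnj (u t \<theta>) * u t \<theta>)"
    by (intro wiener_continuous_mult wiener_continuous_cnj assms)
  then show ?thesis
    unfolding cubic_def abs_sq_def complex_norm_square by (rule wiener_continuous_szego_proj)
qed

lemma wiener_continuous_velocity:
  "wiener_continuous u \<Longrightarrow> wiener_continuous (\<lambda>t. velocity \<beta> (u t))"
  unfolding velocity_def
  by (intro wiener_continuous_scale wiener_continuous_diff wiener_continuous_shift
      wiener_continuous_cubic wiener_continuous_shift_adj)

lemma wiener_continuous_sobolev:
  assumes "s > 1/2" "continuous_sobolev_plus s u"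
  shows "wiener_continuous u"
proof -
  obtain C where C: "\<And>f. f \<in> sobolev s \<Longrightarrow> f \<in> wiener"
    "\<And>f. f \<in> sobolev s \<Longrightarrow> wiener_norm f \<le> C * sobolev_norm s f"
    using wiener_sobolev[OF assms(1)] by blast
  have u: "u t \<in> sobolev s" for t
    using assms(2) by (simp add: continuous_sobolev_plus_def sobolev_plus_def)
  show ?thesis
    unfolding wiener_continuous_def
  proof (intro conjI allI C(1) u)
    fix t
    have le: "wiener_norm (\<lambda>\<theta>. u r \<theta> - u t \<theta>) \<le> C * sobolev_norm s (\<lambda>\<theta>. u r \<theta> - u t \<theta>)" for r
      by (intro C(2) sobolev_diff u)
    have "((\<lambda>r. C * sobolev_norm s (\<lambda>\<theta>. u r \<theta> - u t \<theta>))
        \<longlongrightarrow> C * 0) (at t)"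
      using assms(2) by (intro tendsto_mult tendsto_const) (simp add: continuous_sobolev_plus_def)
    then have "((\<lambda>r. C * sobolev_norm s (\<lambda>\<theta>. u r \<theta> - u t \<theta>)) \<longlongrightarrow> 0) (at t)"
      by simp
    then show "((\<lambda>r. wiener_norm (\<lambda>\<theta>. u r \<theta> - u t \<theta>)) \<longlongrightarrow> 0) (at t)"
      by (rule Lim_null_comparison[rotated]) (simp add: le)
  qed
qed

subsection \<open>Differentiability in the Wiener algebra\<close>

lemma fourier_divide: "fourier (\<lambda>\<theta>. f \<theta> / c) n = fourier f n / c"
  using fourier_scale[of "inverse c" f n] by (simp add: divide_inverse mult.commute)

lemma L2_divide: "f \<in> L2 \<Longrightarrow> (\<lambda>\<theta>. f \<theta> / c) \<in> L2"
  using L2_scale[of f "inverse c"] by (simp add: divide_inverse mult.commute)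

text \<open>A Fourier coefficient is a linear functional of norm at most 1 on \<open>L2\<close>, so
  it inherits differentiability from the curve.\<close>

lemma fourier_has_vector_derivative:
  assumes u: "\<And>t. u t \<in> L2" and deriv: "has_L2_derivative u v t"
  shows "((\<lambda>r. fourier (u r) n) has_vector_derivative fourier v n) (at t)"
proof -
  have v: "v \<in> L2"
    and lim: "((\<lambda>r. L2_norm (\<lambda>\<theta>. (u (t + r) \<theta> - u t \<theta>) / complex_of_real r - v \<theta>)) \<longlongrightarrow> 0) (at 0)"
    using deriv by (auto simp: has_L2_derivative_def)
  have "((\<lambda>r. norm (fourier (u (t + r)) n - fourier (u t) n - r *\<^sub>R fourier v n) / norm r) \<longlongrightarrow> 0) (at 0)"
  proof (rule tendsto_sandwich[OF _ _ tendsto_const lim])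
    show "\<forall>\<^sub>F r in at 0. norm (fourier (u (t + r)) n - fourier (u t) n - r *\<^sub>R fourier v n) / norm r
        \<le> L2_norm (\<lambda>\<theta>. (u (t + r) \<theta> - u t \<theta>) / complex_of_real r - v \<theta>)"
      using eventually_neq_at_within[of 0 0 UNIV]
    proof eventually_elim
      case (elim r)
      let ?q = "\<lambda>\<theta>. (u (t + r) \<theta> - u t \<theta>) / complex_of_real r - v \<theta>"
      have "fourier ?q n = (fourier (u (t + r)) n - fourier (u t) n) / complex_of_real r - fourier v n"
        using u v by (simp add: fourier_diff fourier_divide L2_diff L2_divide L2_integrable)
      also have "\<dots> = (fourier (u (t + r)) n - fourier (u t) n - r *\<^sub>R fourier v n) / complex_of_real r"
        using elim by (simp add: field_simps scaleR_conv_of_real)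
      finally have "norm (fourier (u (t + r)) n - fourier (u t) n - r *\<^sub>R fourier v n) / norm r
          = cmod (fourier ?q n)"
        by (simp add: norm_divide)
      also have "\<dots> \<le> L2_norm ?q"
        by (intro cmod_fourier_le L2_diff L2_divide u v)
      finally show ?case .
    qed
  qed simp
  then show ?thesis
    unfolding has_vector_derivative_def has_derivative_at by (simp add: bounded_linear_scaleR_left)
qed

text \<open>
  A mean value argument, one finite set of frequencies at a time: \<open>L\<^sup>2\<close>-differentiability is
  upgraded to differentiability in the Wiener algebra because the derivative is continuous there.
\<close>

lemma wiener_difference_quotient:
  assumes u: "\<And>t. u t \<in> wiener" and v: "wiener_continuous v"
    and deriv: "\<And>t n. ((\<lambda>r. fourier (u r) n) has_vector_derivative fourier (v t) n) (at t)"
    and "\<epsilon> > 0"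
  shows "\<forall>\<^sub>F r in at 0. wiener_norm (\<lambda>\<theta>. (u (t + r) \<theta> - u t \<theta>) / complex_of_real r - v t \<theta>) \<le> \<epsilon>"
proof -
  note vw = wiener_continuous_wiener[OF v]
  have "((\<lambda>r. wiener_norm (\<lambda>\<theta>. v r \<theta> - v t \<theta>)) \<longlongrightarrow> 0) (at t)"
    using v by (simp add: wiener_continuous_def)
  then have "\<forall>\<^sub>F r in at t. wiener_norm (\<lambda>\<theta>. v r \<theta> - v t \<theta>) < \<epsilon>"
    using \<open>\<epsilon> > 0\<close> by (rule order_tendstoD)
  then obtain d where d: "d > 0"
    "\<And>r. r \<noteq> t \<Longrightarrow> dist r t < d \<Longrightarrow> wiener_norm (\<lambda>\<theta>. v r \<theta> - v t \<theta>) < \<epsilon>"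
    by (auto simp: eventually_at)
  \<comment> \<open>The limit says nothing at \<open>t\<close> itself; there the difference is the
    zero function.\<close>
  have v_close: "wiener_norm (\<lambda>\<theta>. v \<tau> \<theta> - v t \<theta>) \<le> \<epsilon>" if "dist \<tau> t < d" for \<tau>
    using d(2)[of \<tau>] that \<open>\<epsilon> > 0\<close>
    by (cases "\<tau> = t") (auto simp: wiener_norm_def fourier_def)
  have "wiener_norm (\<lambda>\<theta>. (u (t + r) \<theta> - u t \<theta>) / complex_of_real r - v t \<theta>) \<le> \<epsilon>"
    if r: "r \<noteq> 0" "\<bar>r\<bar> < d" for r
  proof -
    let ?q = "\<lambda>\<theta>. (u (t + r) \<theta> - u t \<theta>) / complex_of_real r - v t \<theta>"
    define z where "z n = fourier ?q n" for n
    have z: "z n = (fourier (u (t + r)) n - fourier (u t) n) / complex_of_real r - fourier (v t) n" for n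
      unfolding z_def using u vw
      by (simp add: fourier_diff fourier_divide L2_diff L2_divide L2_integrable wiener_L2)
    have "(\<lambda>\<theta>. inverse (complex_of_real r) * (u (t + r) \<theta> - u t \<theta>) - v t \<theta>) \<in> wiener"
      by (intro wiener_diff wiener_scale u vw)
    then have "?q \<in> wiener"
      by (simp add: divide_inverse mult.commute)
    then have "(\<lambda>n. cmod (z n)) summable_on UNIV"
      unfolding z_def by (rule wiener_summable)
    moreover have "(\<Sum>n\<in>F. cmod (z n)) \<le> \<epsilon>" if F: "finite F" for F
    proof -
      \<comment> \<open>Conjugate phases turn the sum of the moduli of \<open>z\<close> into one
        linear combination of coefficients, so a single mean value estimate for \<open>f\<close>
        bounds the whole sum, independently of \<open>F\<close>.\<close>
      define c where "c n = cnj (sgn (z n))" for n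
      have c: "c n * z n = of_real (cmod (z n))" "cmod (c n) \<le> 1" for n
        by (auto simp: c_def sgn_eq norm_divide mult.commute[of _ "z n"] complex_norm_square
              power2_eq_square divide_simps simp flip: complex_norm_square)
      define f where "f \<tau> = (\<Sum>n\<in>F. c n * fourier (u \<tau>) n)" for \<tau>
      define f' where "f' \<tau> = (\<Sum>n\<in>F. c n * fourier (v \<tau>) n)" for \<tau>
      have f': "(f has_vector_derivative f' \<tau>) (at \<tau> within closed_segment t (t + r))" for \<tau>
        unfolding f_def[abs_def] f'_def
        by (intro has_vector_derivative_sum has_vector_derivative_mult_right
            has_vector_derivative_at_within[OF deriv])
      \<comment> \<open>The mean value inequality for the remainder after the linear term at
        \<open>t\<close>; the closed segment treats both signs of \<open>r\<close> alike.\<close>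
      have "norm (f (t + r) - f t - (t + r - t) *\<^sub>R f' t) \<le> norm (t + r - t) * \<epsilon>"
      proof (rule vector_differentiable_bound_linearization[OF f'])
        fix \<tau> assume "\<tau> \<in> closed_segment t (t + r)"
        then have "dist \<tau> t < d"
          using r dist_in_closed_segment[of \<tau> t "t + r"] by (simp add: dist_real_def)
        have wd: "(\<lambda>\<theta>. v \<tau> \<theta> - v t \<theta>) \<in> wiener"
          by (intro wiener_diff vw)
        have "f' \<tau> - f' t = (\<Sum>n\<in>F. c n * fourier (\<lambda>\<theta>. v \<tau> \<theta> - v t \<theta>) n)"
          unfolding f'_def using vw
          by (simp add: fourier_diff L2_integrable wiener_L2 right_diff_distrib sum_subtractf)
        also have "norm \<dots> \<le> (\<Sum>n\<in>F. cmod (fourier (\<lambda>\<theta>. v \<tau> \<theta> - v t \<theta>) n))"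
          by (rule sum_norm_le) (simp add: norm_mult c(2) mult_left_le_one_le)
        also have "\<dots> \<le> wiener_norm (\<lambda>\<theta>. v \<tau> \<theta> - v t \<theta>)"
          unfolding wiener_norm_def using F by (intro finite_sum_le_infsum wiener_summable wd) auto
        also have "\<dots> \<le> \<epsilon>"
          by (rule v_close) fact
        finally show "norm (f' \<tau> - f' t) \<le> \<epsilon>" .
      qed auto
      moreover have "f (t + r) - f t - (t + r - t) *\<^sub>R f' t = complex_of_real r * (\<Sum>n\<in>F. c n * z n)"
      proof -
        have "complex_of_real r * (c n * z n)
            = c n * fourier (u (t + r)) n - c n * fourier (u t) n - complex_of_real r * (c n * fourier (v t) n)" for n
          using r(1) by (simp add: z field_simps)
        then show ?thesis
          by (simp add: f_def f'_def sum_distrib_left sum_subtractf scaleR_conv_of_real)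
      qed
      moreover have "(\<Sum>n\<in>F. c n * z n) = complex_of_real (\<Sum>n\<in>F. cmod (z n))"
        by (simp add: c(1))
      ultimately have "\<bar>r\<bar> * (\<Sum>n\<in>F. cmod (z n)) \<le> \<bar>r\<bar> * \<epsilon>"
        by (simp add: norm_mult sum_nonneg del: of_real_sum)
      then show ?thesis
        using r(1) by simp
    qed
    ultimately show ?thesis
      unfolding wiener_norm_def z_def by (rule infsum_le_finite_sums)
  qed
  then show ?thesis
    unfolding eventually_at using d(1) by (intro exI[of _ d]) (simp add: dist_real_def)
qed

text \<open>The derivatives provided by the equation are separate representatives, one for each
  time. Their coefficients are those of \<open>velocity\<close>, a single curve to which the
  continuity argument applies.\<close>

lemma solves_beta_szego_velocity:
  assumes u: "\<And>t. u t \<in> wiener" and sol: "solves_beta_szego \<beta> u"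
  shows "((\<lambda>r. fourier (u r) n) has_vector_derivative fourier (velocity \<beta> (u t)) n) (at t)"
proof -
  obtain v where v: "has_L2_derivative u v t" and ae: "AE \<theta> in circle. \<i> * v \<theta> =
        cubic (u t) \<theta> - complex_of_real \<beta> * shift (cubic (shift_adj (u t))) \<theta>"
    using sol unfolding solves_beta_szego_def cubic_def by metis
  have "v \<in> L2"
    using v by (simp add: has_L2_derivative_def)
  moreover have "velocity \<beta> (u t) \<in> L2"
    by (intro wiener_L2 velocity_wiener u)
  moreover have "AE \<theta> in circle. v \<theta> = velocity \<beta> (u t) \<theta>"
    using ae
  proof eventually_elim
    case (elim \<theta>)
    have "v \<theta> = - \<i> * (\<i> * v \<theta>)"
      by simp
    then show ?case
      unfolding elim by (simp only: velocity_def)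
  qed
  ultimately have "fourier v = fourier (velocity \<beta> (u t))"
    by (intro fourier_cong_AE L2_measurable)
  then show ?thesis
    using fourier_has_vector_derivative[OF wiener_L2[OF u] v] by simp
qed

theorem mainTheorem6:
  fixes \<beta> s :: real and u :: "real \<Rightarrow> real \<Rightarrow> complex"
  assumes "s > 1/2"
    and "continuous_sobolev_plus s u"
    and "solves_beta_szego \<beta> u"
  shows "\<forall>t. has_operator_derivative (\<lambda>r. K_op (u r))
           (commutator
              (\<lambda>h \<theta>. C_op (u t) h \<theta> - complex_of_real \<beta> * B_op (shift_adj (u t)) h \<theta>)
              (K_op (u t))) t"
proof
  fix t
  have u_cont: "wiener_continuous u"
    by (rule wiener_continuous_sobolev[OF assms(1,2)])
  note uw = wiener_continuous_wiener[OF u_cont]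
  have u_plus: "u r \<in> L2_plus" for r
    using assms(2) by (simp add: continuous_sobolev_plus_def sobolev_plus_def)
  define V where "V = velocity \<beta> (u t)"
  have V: "V \<in> wiener"
    unfolding V_def by (rule velocity_wiener[OF uw])
  define D where "D = commutator
      (\<lambda>h \<theta>. C_op (u t) h \<theta> - complex_of_real \<beta> * B_op (shift_adj (u t)) h \<theta>) (K_op (u t))"
  have D_L2: "D h \<in> L2" and D: "fourier (D h) n = fourier (K_op V h) n" if "h \<in> L2_plus" for h n
    unfolding D_def V_def by (rule lax_commutator[OF uw u_plus that])+
  have K_plus: "K_op f h \<in> L2_plus" if "f \<in> wiener" "h \<in> L2_plus" for f h
    using that by (simp add: K_op_eq L2_plus_L2 shifted_hankel_L2_plus)
  have K: "fourier (K_op f h) n = (if n \<ge> 0 then fourier (\<lambda>\<theta>. f \<theta> * cnj (h \<theta>)) (n + 1) else 0)"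
    if "f \<in> wiener" "h \<in> L2_plus" for f h n
    using that by (simp add: K_op_eq L2_plus_L2 fourier_shifted_hankel)
  have ev: "\<forall>\<^sub>F r in at 0. \<forall>h\<in>L2_plus.
      L2_norm (\<lambda>\<theta>. (K_op (u (t + r)) h \<theta> - K_op (u t) h \<theta>) / complex_of_real r - D h \<theta>) \<le> \<epsilon> * L2_norm h"
    if "\<epsilon> > 0" for \<epsilon>
    \<comment> \<open>The range of \<open>r\<close> is fixed by the symbol alone, before
      \<open>h\<close> is chosen; this gives the uniformity in \<open>h\<close> that the operator
      norm demands.\<close>
    using wiener_difference_quotient[OF uw wiener_continuous_velocity[OF u_cont]
        solves_beta_szego_velocity[OF uw assms(3)] that, where t=t]
  proof eventually_elim
    case (elim r)
    define q where "q \<theta> = (u (t + r) \<theta> - u t \<theta>) / complex_of_real r - V \<theta>" for \<theta>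
    have "(\<lambda>\<theta>. inverse (complex_of_real r) * (u (t + r) \<theta> - u t \<theta>) - V \<theta>) \<in> wiener"
      by (intro wiener_diff wiener_scale uw V)
    then have q: "q \<in> wiener"
      by (simp add: q_def[abs_def] divide_inverse mult.commute)
    have q_le: "wiener_norm q \<le> \<epsilon>"
      using elim by (simp add: q_def[abs_def] V_def)
    show ?case
    proof
      fix h assume h: "h \<in> L2_plus"
      note h2 = L2_plus_L2[OF h]
      note L2_rules = L2_diff L2_divide L2_plus_L2[OF K_plus[OF uw h]] D_L2[OF h]
        wiener_mult_cnj_L2[OF uw h2] wiener_mult_cnj_L2[OF V h2]
      let ?F = "\<lambda>\<theta>. (K_op (u (t + r)) h \<theta> - K_op (u t) h \<theta>) / complex_of_real r - D h \<theta>"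
      have q_fourier: "fourier (\<lambda>\<theta>. q \<theta> * cnj (h \<theta>)) m
          = (fourier (\<lambda>\<theta>. u (t + r) \<theta> * cnj (h \<theta>)) m - fourier (\<lambda>\<theta>. u t \<theta> * cnj (h \<theta>)) m) / complex_of_real r
            - fourier (\<lambda>\<theta>. V \<theta> * cnj (h \<theta>)) m" for m
      proof -
        have "(\<lambda>\<theta>. q \<theta> * cnj (h \<theta>)) = (\<lambda>\<theta>. (u (t + r) \<theta> * cnj (h \<theta>) - u t \<theta> * cnj (h \<theta>)) / complex_of_real r
            - V \<theta> * cnj (h \<theta>))"
          by (simp add: q_def fun_eq_iff diff_divide_distrib left_diff_distrib)
        then show ?thesis
          by (simp add: fourier_diff fourier_divide L2_integrable L2_rules)
      qed
      have F: "fourier ?F n = (fourier (K_op (u (t + r)) h) n - fourier (K_op (u t) h) n) / complex_of_real r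
          - fourier (K_op V h) n" for n
        by (simp add: fourier_diff fourier_divide L2_integrable L2_rules D[OF h])
      have "?F \<in> L2"
        by (intro L2_diff L2_divide D_L2[OF h] L2_plus_L2[OF K_plus[OF uw h]])
      \<comment> \<open>On coefficients \<open>?F\<close> is \<open>K_op q h\<close>: at
        \<open>n \<ge> 0\<close> it has the coefficient of \<open>q\<close> times the conjugate of
        \<open>h\<close> at \<open>n + 1\<close>, and at negative \<open>n\<close> it has 0.\<close>
      then have "L2_norm ?F \<le> L2_norm (\<lambda>\<theta>. q \<theta> * cnj (h \<theta>))"
      proof (rule L2_norm_dominated_reindex[where \<phi>="\<lambda>n. n + 1", rotated])
        show "cmod (fourier ?F n) \<le> cmod (fourier (\<lambda>\<theta>. q \<theta> * cnj (h \<theta>)) (n + 1))" for n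
          unfolding F q_fourier by (simp add: K uw V h)
      qed (auto intro: wiener_mult_cnj_L2 q h2 simp: inj_def)
      also have "\<dots> \<le> wiener_norm q * L2_norm (\<lambda>\<theta>. cnj (h \<theta>))"
        by (intro L2_norm_wiener_mult_le q L2_cnj h2)
      also have "\<dots> \<le> \<epsilon> * L2_norm h"
        using q_le by (simp add: L2_norm_def mult_right_mono)
      finally show "L2_norm ?F \<le> \<epsilon> * L2_norm h" .
    qed
  qed
  \<comment> \<open>That \<open>D\<close> maps into \<open>L2_plus\<close> is also read off from its
    coefficients, which are those of \<open>K_op V h\<close>.\<close>
  have "has_operator_derivative (\<lambda>r. K_op (u r)) D t"
    unfolding has_operator_derivative_def
    using ev by (auto intro: K_plus uw simp: L2_plus_iff[of "D _"] D_L2 D K V)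
  then show "has_operator_derivative (\<lambda>r. K_op (u r))
           (commutator
              (\<lambda>h \<theta>. C_op (u t) h \<theta> - complex_of_real \<beta> * B_op (shift_adj (u t)) h \<theta>)
              (K_op (u t))) t"
    by (simp only: D_def)
qed

end
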